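(* Let $H$ be a Hilbert space and let $T_1,T_2\in B(H)$ be commuting contractions. Assume that there is an Agler--McCarthy distinguished variety $V\subset \mathbb{D}^2$ for $(T_1,T_2)$. Then $\overline{V}$ is a spectral set for $(T_1,T_2)$.
   Context: $\mathbb{D}\subset\mathbb{C}$ is the open unit disc. Spectral sets: let $\sigma(T_1,T_2)$ be the Taylor spectrum. For a compact set $X\subset\mathbb{C}^2$, $\mathcal{R}(X)$ is the algebra of restrictions to $X$ of rational functions with poles outside of $X$. A compact set $X\subset\mathbb{C}^2$ containing $\sigma(T_1,T_2)$ is a spectral set for $(T_1,T_2)$ if $\|r(T_1,T_2)\|\le \sup_X|r|$ for every $r\in\mathcal{R}(X)$, where $r(T_1,T_2)$ is given by the Taylor functional calculus (so $r(T_1,T_2)=p(T_1,T_2)q(T_1,T_2)^{-1}$ if $r=p/q$ with $p,q$ polynomials and $q$ non-vanishing on $X$). Agler--McCarthy varieties: let $E$ be a finite-dimensional Hilbert space and $\Psi:\mathbb{D}\to B(E)$ a contractive holomorphic function. Put $V_\Psi=\{(z,w)\in\mathbb{D}^2:\det(\Psi(z)-wI)=0\}$. The set $V_\Psi$ is an Agler--McCarthy variety for $(T_1,T_2)$ if $\|p(T_1,T_2)\|\le\sup_{V_\Psi}|p|$ for every polynomial $p$ in two variables. It is distinguished if it is non-empty and $\overline{V_\Psi}$ exits $\mathbb{D}^2$ through the distinguished boundary, i.e. $\overline{V_\Psi}\cap\partial(\mathbb{D}^2)\subset\mathbb{T}^2$ where $\mathbb{T}=\partial\mathbb{D}$. It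 is known that the distinguished varieties of this form are precisely the sets $V_\Psi$ with $\Psi$ a rational matrix-valued inner function that is pure (i.e. $\sigma(\Psi(\lambda))\subset\mathbb{D}$ for every $\lambda\in\mathbb{D}$). An Agler--McCarthy distinguished variety for $(T_1,T_2)$ is an Agler--McCarthy variety for $(T_1,T_2)$ that is distinguished. *)

theory Defs
  imports "HOL-Complex_Analysis.Complex_Analysis" "HOL-Computational_Algebra.Polynomial"
begin

text \<open>Complex Hilbert spaces. The inner product is linear in its first argument; positive
  definiteness is contained in \<open>cinner_self\<close>, since \<open>norm\<close> is already a norm.\<close>

class scaleC =
  fixes scaleC :: "complex \<Rightarrow> 'a \<Rightarrow> 'a"  (infixr "*\<^sub>C" 75)

class chilbert_space = banach + scaleC +
  fixes cinner :: "'a \<Rightarrow> 'a \<Rightarrow> complex"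
  assumes scaleC_add_right: "a *\<^sub>C (x + y) = a *\<^sub>C x + a *\<^sub>C y"
    and scaleC_add_left: "(a + b) *\<^sub>C x = a *\<^sub>C x + b *\<^sub>C x"
    and scaleC_scaleC: "a *\<^sub>C (b *\<^sub>C x) = (a * b) *\<^sub>C x"
    and scaleR_scaleC: "r *\<^sub>R x = complex_of_real r *\<^sub>C x"
    and cinner_commute: "cinner x y = cnj (cinner y x)"
    and cinner_add_left: "cinner (x + y) z = cinner x z + cinner y z"
    and cinner_scaleC_left: "cinner (a *\<^sub>C x) y = a * cinner x y"
    and cinner_self: "cinner x x = complex_of_real ((norm x)\<^sup>2)"

instantiation complex :: chilbert_space
begin

definition scaleC_complex :: "complex \<Rightarrow> complex \<Rightarrow> complex" where
  "scaleC_complex a x = a * x"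

definition cinner_complex :: "complex \<Rightarrow> complex \<Rightarrow> complex" where
  "cinner_complex x y = x * cnj y"

instance
proof
  fix a b x y z :: complex and r :: real
  show "a *\<^sub>C (x + y) = a *\<^sub>C x + a *\<^sub>C y" "(a + b) *\<^sub>C x = a *\<^sub>C x + b *\<^sub>C x"
    "a *\<^sub>C (b *\<^sub>C x) = (a * b) *\<^sub>C x" "r *\<^sub>R x = complex_of_real r *\<^sub>C x"
    by (simp_all add: scaleC_complex_def distrib_left distrib_right scaleR_conv_of_real)
  show "cinner x y = cnj (cinner y x)" "cinner (x + y) z = cinner x z + cinner y z"
    "cinner (a *\<^sub>C x) y = a * cinner x y"
    by (simp_all add: scaleC_complex_def cinner_complex_def distrib_right)
  show "cinner x x = complex_of_real ((norm x)\<^sup>2)"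
    unfolding cinner_complex_def by (rule complex_norm_square [symmetric])
qed

end

definition bounded_clinear :: "('a::chilbert_space \<Rightarrow> 'a) \<Rightarrow> bool" where
  "bounded_clinear T \<longleftrightarrow> bounded_linear T \<and> (\<forall>c x. T (c *\<^sub>C x) = c *\<^sub>C T x)"

definition contraction :: "('a::chilbert_space \<Rightarrow> 'a) \<Rightarrow> bool" where
  "contraction T \<longleftrightarrow> bounded_clinear T \<and> onorm T \<le> 1"

text \<open>A polynomial \<open>p(z,w)\<close> in two variables is an element of \<open>\<complex>[z][w]\<close>:
  the coefficient of \<open>z\<^sup>i w\<^sup>j\<close> is \<open>coeff (coeff p j) i\<close>.\<close>

definition poly2 :: "complex poly poly \<Rightarrow> complex \<times> complex \<Rightarrow> complex" where
  "poly2 p = (\<lambda>(z, w). \<Sum>j\<le>degree p. \<Sum>i\<le>degree (coeff p j). coeff (coeff p j) i * z ^ i * w ^ j)"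

definition poly2_op ::
  "complex poly poly \<Rightarrow> ('a::chilbert_space \<Rightarrow> 'a) \<Rightarrow> ('a \<Rightarrow> 'a) \<Rightarrow> 'a \<Rightarrow> 'a" where
  "poly2_op p T1 T2 =
    (\<lambda>x. \<Sum>j\<le>degree p. \<Sum>i\<le>degree (coeff p j). coeff (coeff p j) i *\<^sub>C (T1 ^^ i) ((T2 ^^ j) x))"

text \<open>The supremum is taken in \<open>[0,\<infinity>)\<close>, so that it is \<open>0\<close> over the empty set
  (where \<open>Sup\<close> on \<^typ>\<open>real\<close> is unspecified). It is used below only for functions bounded on \<open>X\<close>.\<close>

definition sup_norm :: "'b set \<Rightarrow> ('b \<Rightarrow> complex) \<Rightarrow> real" where
  "sup_norm X f = Sup (insert 0 ((\<lambda>x. cmod (f x)) ` X))"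

text \<open>For commuting \<open>A, B\<close>: exactness of the Koszul complex \<open>0 \<rightarrow> H \<rightarrow> H \<oplus> H \<rightarrow> H \<rightarrow> 0\<close>
  with maps \<open>x \<mapsto> (A x, B x)\<close> and \<open>(x, y) \<mapsto> A y - B x\<close>.\<close>

definition koszul_exact :: "('a::chilbert_space \<Rightarrow> 'a) \<Rightarrow> ('a \<Rightarrow> 'a) \<Rightarrow> bool" where
  "koszul_exact A B \<longleftrightarrow>
    {x. (A x, B x) = (0, 0)} = {0} \<and>
    {(x, y). A y - B x = 0} = range (\<lambda>x. (A x, B x)) \<and>
    range (\<lambda>(x, y). A y - B x) = UNIV"

definition taylor_spectrum ::
  "('a::chilbert_space \<Rightarrow> 'a) \<Rightarrow> ('a \<Rightarrow> 'a) \<Rightarrow> (complex \<times> complex) set" where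
  "taylor_spectrum T1 T2 =
    {(a, b). \<not> koszul_exact (\<lambda>x. T1 x - a *\<^sub>C x) (\<lambda>x. T2 x - b *\<^sub>C x)}"

text \<open>The rational functions with poles off \<open>X\<close> are the \<open>p/q\<close> with \<open>q\<close> non-vanishing on \<open>X\<close>.
  The (unique) operator \<open>S\<close> is \<open>q(T1,T2)\<^sup>-\<^sup>1\<close>; it exists by the spectral mapping theorem
  when the Taylor spectrum is contained in \<open>X\<close>.\<close>

definition spectral_set ::
  "(complex \<times> complex) set \<Rightarrow> ('a::chilbert_space \<Rightarrow> 'a) \<Rightarrow> ('a \<Rightarrow> 'a) \<Rightarrow> bool" where
  "spectral_set X T1 T2 \<longleftrightarrow>
    compact X \<and> taylor_spectrum T1 T2 \<subseteq> X \<and>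
    (\<forall>p q. (\<forall>x\<in>X. poly2 q x \<noteq> 0) \<longrightarrow>
      (\<exists>S. bounded_clinear S \<and> S \<circ> poly2_op q T1 T2 = id \<and> poly2_op q T1 T2 \<circ> S = id \<and>
        onorm (poly2_op p T1 T2 \<circ> S) \<le> sup_norm X (\<lambda>x. poly2 p x / poly2 q x)))"

abbreviation disc :: "complex set"  ("\<bbbD>") where
  "\<bbbD> \<equiv> ball 0 1"

text \<open>The finite-dimensional Hilbert space is \<open>\<complex>\<^sup>n\<close>: the norm on \<^typ>\<open>complex ^ 'n\<close> is the
  Euclidean one, so \<^const>\<open>onorm\<close> is the operator norm of the matrix.\<close>

definition contractive_holomorphic :: "(complex \<Rightarrow> complex ^ 'n ^ 'n) \<Rightarrow> bool" where
  "contractive_holomorphic \<Psi> \<longleftrightarrow>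
    (\<forall>i j. (\<lambda>z. \<Psi> z $ i $ j) holomorphic_on \<bbbD>) \<and> (\<forall>z\<in>\<bbbD>. onorm ((*v) (\<Psi> z)) \<le> 1)"

definition variety :: "(complex \<Rightarrow> complex ^ 'n ^ 'n) \<Rightarrow> (complex \<times> complex) set" where
  "variety \<Psi> = {(z, w) \<in> \<bbbD> \<times> \<bbbD>. det (\<Psi> z - mat w) = 0}"

definition agler_mccarthy_variety ::
  "(complex \<Rightarrow> complex ^ 'n ^ 'n) \<Rightarrow> ('a::chilbert_space \<Rightarrow> 'a) \<Rightarrow> ('a \<Rightarrow> 'a) \<Rightarrow> bool" where
  "agler_mccarthy_variety \<Psi> T1 T2 \<longleftrightarrow>
    contractive_holomorphic \<Psi> \<and>
    (\<forall>p. onorm (poly2_op p T1 T2) \<le> sup_norm (variety \<Psi>) (poly2 p))"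

definition distinguished :: "(complex \<times> complex) set \<Rightarrow> bool" where
  "distinguished V \<longleftrightarrow>
    V \<noteq> {} \<and> closure V \<inter> frontier (\<bbbD> \<times> \<bbbD>) \<subseteq> sphere 0 1 \<times> sphere 0 1"

end

theory Submission
  imports Defs "HOL-Computational_Algebra.Polynomial_Factorial"
    "HOL-Computational_Algebra.Field_as_Ring"
    "HOL-Computational_Algebra.Fundamental_Theorem_Algebra"
begin

text \<open>
  Let \<open>X\<close> be the closure of the distinguished variety \<open>V\<close>. Everything follows from a description of
  \<open>X\<close> as a piece of an algebraic curve: there is a polynomial \<open>Q(z,w)\<close> with
  \<open>X = {(z,w). \<bar>z\<bar> \<le> 1, Q(z,w) = 0}\<close>.

  To find \<open>Q\<close>, take the characteristic polynomial of \<open>\<Psi>(z)\<close>, a monic polynomial in \<open>w\<close> whose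
  coefficients are holomorphic in \<open>z\<close>. By Hurwitz's theorem its unimodular roots do not depend on \<open>z\<close>
  and can be divided out (\<open>strip_unimodular_roots\<close>); the roots of the remaining family \<open>P(z,w)\<close> are the
  points of \<open>V\<close>. Since \<open>V\<close> is distinguished, they tend to the unit circle as \<open>\<bar>z\<bar>\<close> tends to \<open>1\<close>. So
  \<open>\<phi> = P(\<cdot>, 0)\<close> has modulus \<open>1\<close> on the circle and is a finite Blaschke product (\<open>finite_blaschke\<close>). A monic
  polynomial with unimodular roots coincides with its reversed conjugate up to a unimodular factor,
  which gives \<open>P(z,w) = w\<^sup>m \<phi>(z) cnj (P(z,w))\<close> for \<open>\<bar>z\<bar> = \<bar>w\<bar> = 1\<close>. Multiplication by the denominator
  \<open>B\<close> of \<open>\<phi>\<close> turns this into a symmetry of Fourier coefficients which leaves only finitely many of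
  them (\<open>polynomial_of_symmetry\<close>). Hence \<open>Q(z,w) = B(z) P(z,w)\<close> is a polynomial
  (\<open>monic_family_algebraic\<close>).

  Let now \<open>q\<close> be a polynomial without zeros on \<open>X\<close>. Then \<open>Q\<close> and \<open>q\<close> have no common zero over the closed
  disc, and eliminating \<open>w\<close> gives \<open>u Q + v q = \<rho>(z)\<close> with \<open>\<rho>\<close> zero-free on the closed disc
  (\<open>eliminant_without_zeros\<close>). So \<open>1/q = v/\<rho>\<close> on \<open>X\<close>, and this is a uniform limit of polynomials
  \<open>u\<^sub>n\<close>. The inequality assumed for polynomials makes \<open>u\<^sub>n(T\<^sub>1,T\<^sub>2)\<close> converge in norm to an inverse
  of \<open>q(T\<^sub>1,T\<^sub>2)\<close> and passes to the limit for every \<open>p/q\<close> (\<open>inverse_of_approximable\<close>). Finally, every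
  point outside \<open>X\<close> is a zero of some \<open>q\<close> without zeros on \<open>X\<close>. Writing this \<open>q\<close> as
  \<open>f (z - a) + g (w - b)\<close>, the invertibility of \<open>q(T\<^sub>1,T\<^sub>2)\<close> makes the Koszul complex at \<open>(a,b)\<close> exact
  (\<open>koszul_exact_of_invertible\<close>), so the Taylor spectrum is contained in \<open>X\<close>.
\<close>

section \<open>Polynomials in two variables and their functional calculus\<close>

lemma poly2_eq: "poly2 p (z, w) = poly (poly p [:w:]) z"
proof -
  have "poly (poly p [:w:]) z = (\<Sum>j\<le>degree p. poly (coeff p j) z * w ^ j)"
    by (simp add: poly_altdef[of p] poly_sum)
  also have "\<dots> = (\<Sum>j\<le>degree p. \<Sum>i\<le>degree (coeff p j). coeff (coeff p j) i * z ^ i * w ^ j)"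
    by (simp add: poly_altdef[of "coeff p _"] sum_distrib_right)
  finally show ?thesis by (simp add: poly2_def)
qed

lemma poly2_simps [simp]:
  "poly2 0 x = 0" "poly2 1 x = 1"
  "poly2 (p + q) x = poly2 p x + poly2 q x"
  "poly2 (p - q) x = poly2 p x - poly2 q x"
  "poly2 (p * q) x = poly2 p x * poly2 q x"
  by (cases x; simp add: poly2_eq)+

lemma poly2_const [simp]: "poly2 [:c:] (z, w) = poly c z"
  by (simp add: poly2_eq)

lemma poly2_pCons: "poly2 (pCons c p) (z, w) = poly c z + w * poly2 p (z, w)"
  by (simp add: poly2_eq)

lemma continuous_on_poly2 [continuous_intros]: "continuous_on A (poly2 p)"
proof -
  have "poly2 p = (\<lambda>x. \<Sum>j\<le>degree p. \<Sum>i\<le>degree (coeff p j).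
      coeff (coeff p j) i * fst x ^ i * snd x ^ j)"
    by (auto simp: poly2_def fun_eq_iff)
  then show ?thesis by (auto intro!: continuous_intros)
qed

lemma poly2_eq_poly_map_poly: "poly2 p (z, w) = poly (map_poly (\<lambda>c. poly c z) p) w"
  by (induction p) (auto simp: poly2_pCons map_poly_pCons)

lemma bounded_clinearD:
  assumes "bounded_clinear T"
  shows "bounded_linear T" "T (c *\<^sub>C x) = c *\<^sub>C T x" "T (x + y) = T x + T y"
    "T (x - y) = T x - T y" "T 0 = 0" "T (sum f A) = (\<Sum>a\<in>A. T (f a))"
  using assms by (auto simp: bounded_clinear_def linear_simps bounded_linear.linear linear_sum)

lemma scaleC_simps [simp]:
  fixes x :: "'a::chilbert_space"
  shows "0 *\<^sub>C x = 0" "1 *\<^sub>C x = x" "a *\<^sub>C (0::'a) = 0"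
proof -
  show "0 *\<^sub>C x = 0" using scaleR_scaleC[of 0 x] by simp
  show "1 *\<^sub>C x = x" using scaleR_scaleC[of 1 x] by simp
  show "a *\<^sub>C (0::'a) = 0" using scaleC_add_right[of a "0::'a" 0] by simp
qed

lemma norm_scaleC: "norm (a *\<^sub>C x) = cmod a * norm (x::'a::chilbert_space)"
proof -
  have "cinner (a *\<^sub>C x) (a *\<^sub>C x) = a * cnj (a * cinner x x)"
    using cinner_commute[of x "a *\<^sub>C x"] by (simp add: cinner_scaleC_left)
  then have "complex_of_real ((norm (a *\<^sub>C x))\<^sup>2) = (a * cnj a) * complex_of_real ((norm x)\<^sup>2)"
    by (simp add: cinner_self)
  also have "\<dots> = complex_of_real ((cmod a * norm x)\<^sup>2)"
    by (simp add: complex_norm_square[symmetric] power_mult_distrib)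
  finally have "(norm (a *\<^sub>C x))\<^sup>2 = (cmod a * norm x)\<^sup>2" by (simp only: of_real_eq_iff)
  then show ?thesis by (simp add: power2_eq_iff_nonneg)
qed

lemma bounded_linear_scaleC: "bounded_linear (\<lambda>x::'a::chilbert_space. a *\<^sub>C x)"
proof (rule bounded_linear_intro)
  show "a *\<^sub>C r *\<^sub>R x = r *\<^sub>R a *\<^sub>C x" for r and x :: 'a
    by (simp add: scaleR_scaleC scaleC_scaleC mult.commute)
  show "norm (a *\<^sub>C x) \<le> norm x * cmod a" for x :: 'a
    by (simp add: norm_scaleC)
qed (rule scaleC_add_right)

lemma bounded_clinear_id: "bounded_clinear id" "bounded_clinear (\<lambda>x. x)"
  by (simp_all add: bounded_clinear_def id_def)

lemma bounded_clinear_comp: "bounded_clinear S \<Longrightarrow> bounded_clinear T \<Longrightarrow> bounded_clinear (\<lambda>x. S (T x))"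
  by (simp add: bounded_clinear_def bounded_linear_compose)

lemma bounded_clinear_add: "bounded_clinear S \<Longrightarrow> bounded_clinear T \<Longrightarrow> bounded_clinear (\<lambda>x. S x + T x)"
  by (simp add: bounded_clinear_def bounded_linear_add scaleC_add_right)

lemma bounded_clinear_scaleC: "bounded_clinear T \<Longrightarrow> bounded_clinear (\<lambda>x. a *\<^sub>C T x)"
  by (simp add: bounded_clinear_def bounded_linear_compose[OF bounded_linear_scaleC]
      scaleC_scaleC mult.commute)

lemma bounded_clinear_zero: "bounded_clinear (\<lambda>x. 0)"
  by (simp add: bounded_clinear_def)

lemma bounded_clinear_sum: "(\<And>i. i \<in> I \<Longrightarrow> bounded_clinear (f i)) \<Longrightarrow> bounded_clinear (\<lambda>x. \<Sum>i\<in>I. f i x)"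
  by (induction I rule: infinite_finite_induct)
     (auto intro: bounded_clinear_add bounded_clinear_zero)

lemma bounded_clinear_funpow: "bounded_clinear T \<Longrightarrow> bounded_clinear (T ^^ n)"
  by (induction n) (auto simp: bounded_clinear_id bounded_clinear_comp comp_def)

context
  fixes T1 T2 :: "'h::chilbert_space \<Rightarrow> 'h"
  assumes T1: "bounded_clinear T1" and T2: "bounded_clinear T2" and comm: "T1 \<circ> T2 = T2 \<circ> T1"
begin

text \<open>Padding the degree bounds with zero coefficients makes the double sum visibly additive
  in \<open>p\<close>.\<close>

lemma poly2_op_bound:
  assumes "degree p \<le> N" "\<And>j. degree (coeff p j) \<le> M"
  shows "poly2_op p T1 T2 x = (\<Sum>j\<le>N. \<Sum>i\<le>M. coeff (coeff p j) i *\<^sub>C (T1 ^^ i) ((T2 ^^ j) x))"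
proof -
  have inner: "(\<Sum>i\<le>degree (coeff p j). coeff (coeff p j) i *\<^sub>C (T1 ^^ i) ((T2 ^^ j) x)) =
      (\<Sum>i\<le>M. coeff (coeff p j) i *\<^sub>C (T1 ^^ i) ((T2 ^^ j) x))" for j
    using assms(2)[of j] by (intro sum.mono_neutral_left) (auto simp: coeff_eq_0)
  show ?thesis
    unfolding poly2_op_def inner
    using assms(1) by (intro sum.mono_neutral_left) (auto simp: coeff_eq_0)
qed

lemma inner_degree_bound: "\<exists>M. \<forall>j. degree (coeff (p::complex poly poly) j) \<le> M"
proof -
  have "degree (coeff p j) \<le> Max ((\<lambda>j. degree (coeff p j)) ` {..degree p})" for j
  proof (cases "j \<le> degree p")
    case True
    then show ?thesis by (intro Max_ge) auto
  next
    case False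
    then have "coeff p j = 0" by (simp add: coeff_eq_0)
    then show ?thesis by simp
  qed
  then show ?thesis by blast
qed

lemma poly2_op_add: "poly2_op (p + q) T1 T2 x = poly2_op p T1 T2 x + poly2_op q T1 T2 x"
proof -
  obtain M1 M2 where M: "\<And>j. degree (coeff p j) \<le> M1" "\<And>j. degree (coeff q j) \<le> M2"
    using inner_degree_bound by metis
  define M where "M = max M1 M2"
  define N where "N = max (degree p) (degree q)"
  have "\<And>j. degree (coeff p j) \<le> M" "\<And>j. degree (coeff q j) \<le> M" "degree p \<le> N" "degree q \<le> N"
    using M by (auto simp: M_def N_def max.coboundedI1 max.coboundedI2)
  moreover from this have "\<And>j. degree (coeff (p + q) j) \<le> M" "degree (p + q) \<le> N"
    by (auto intro: degree_add_le)
  ultimately show ?thesis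
    by (simp add: poly2_op_bound[of _ N M] scaleC_add_left sum.distrib)
qed

lemma poly2_op_zero: "poly2_op 0 T1 T2 x = 0"
  by (simp add: poly2_op_def)

lemma bounded_clinear_poly2_op: "bounded_clinear (poly2_op p T1 T2)"
  unfolding poly2_op_def
  by (intro bounded_clinear_sum bounded_clinear_scaleC
      bounded_clinear_comp[OF bounded_clinear_funpow[OF T1] bounded_clinear_funpow[OF T2]])

lemma poly2_op_monom:
  "poly2_op (monom (monom a i) j) T1 T2 x = a *\<^sub>C (T1 ^^ i) ((T2 ^^ j) x)"
proof -
  have "poly2_op (monom (monom a i) j) T1 T2 x =
      (\<Sum>j'\<le>j. \<Sum>i'\<le>i. coeff (coeff (monom (monom a i) j) j') i' *\<^sub>C (T1 ^^ i') ((T2 ^^ j') x))"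
    by (intro poly2_op_bound) (auto simp: degree_monom_le)
  also have "\<dots> = (\<Sum>j'\<le>j. if j' = j then
      (\<Sum>i'\<le>i. if i' = i then a *\<^sub>C (T1 ^^ i') ((T2 ^^ j') x) else 0) else 0)"
  proof (intro sum.cong refl)
    fix j'
    show "(\<Sum>i'\<le>i. coeff (coeff (monom (monom a i) j) j') i' *\<^sub>C (T1 ^^ i') ((T2 ^^ j') x)) =
        (if j' = j then (\<Sum>i'\<le>i. if i' = i then a *\<^sub>C (T1 ^^ i') ((T2 ^^ j') x) else 0) else 0)"
    proof (cases "j' = j")
      case True
      show ?thesis
        unfolding True by (simp only: refl if_True) (intro sum.cong, auto)
    qed simp
  qed
  also have "\<dots> = a *\<^sub>C (T1 ^^ i) ((T2 ^^ j) x)"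
    by (simp only: sum.delta finite_atMost atMost_iff order_refl if_True)
  finally show ?thesis .
qed

lemma T2_funpow_T1: "(T2 ^^ j) ((T1 ^^ i) x) = (T1 ^^ i) ((T2 ^^ j) x)"
proof -
  have *: "T2 ((T1 ^^ i) x) = (T1 ^^ i) (T2 x)" for i x
    using fun_cong[OF comm, symmetric] by (induction i) (auto simp del: funpow.simps(1))
  show ?thesis by (induction j arbitrary: x) (auto simp: *)
qed

text \<open>Every polynomial is a sum of monomials, so identities that are additive in each
  polynomial need only be checked on monomials.\<close>

lemma poly2_monom_induct:
  assumes "P 0" "\<And>p q. P p \<Longrightarrow> P q \<Longrightarrow> P (p + q)" "\<And>a i j. P (monom (monom a i) j)"
  shows "P (p :: complex poly poly)"
proof -
  have S: "P (\<Sum>k\<in>K. f k)" if "finite K" "\<And>k. P (f k)" for f and K :: "nat set"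
    using that by (induction K) (auto simp: assms)
  have M: "P (monom c j)" for c j
  proof -
    have "monom c j = (\<Sum>i\<le>degree c. monom (monom (coeff c i) i) j)"
      by (subst poly_as_sum_of_monoms[symmetric]) (simp add: monom_sum)
    then show ?thesis by (simp only: S finite_atMost assms(3))
  qed
  have "P (\<Sum>j\<le>degree p. monom (coeff p j) j)"
    by (intro S M) simp
  then show ?thesis by (simp only: poly_as_sum_of_monoms)
qed

lemma poly2_op_mult: "poly2_op (p * q) T1 T2 x = poly2_op p T1 T2 (poly2_op q T1 T2 x)"
proof (induction p arbitrary: x rule: poly2_monom_induct)
  case (3 a i j)
  show ?case
  proof (induction q arbitrary: x rule: poly2_monom_induct)
    case (3 b k l)
    show ?case
      using bounded_clinearD(2)[OF bounded_clinear_funpow[OF T1]]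
        bounded_clinearD(2)[OF bounded_clinear_funpow[OF T2]]
      by (simp add: mult_monom poly2_op_monom scaleC_scaleC T2_funpow_T1 funpow_add)
  qed (simp_all add: distrib_left poly2_op_add poly2_op_zero
      bounded_clinearD[OF bounded_clinear_poly2_op])
qed (simp_all add: poly2_op_add poly2_op_zero distrib_right)

lemma poly2_op_one: "poly2_op 1 T1 T2 x = x"
  using poly2_op_monom[of 1 0 0 x] by (simp add: monom_0 one_pCons)

lemma poly2_op_diff: "poly2_op (p - q) T1 T2 x = poly2_op p T1 T2 x - poly2_op q T1 T2 x"
  using poly2_op_add[of "p - q" q x] by simp

lemma poly2_op_z_minus: "poly2_op [:[:- a, 1:]:] T1 T2 x = T1 x - a *\<^sub>C x"
proof -
  have "[:[:- a, 1:]:] = monom (monom 1 1) 0 - monom (monom a 0) 0"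
    by (simp add: monom_altdef)
  then show ?thesis by (simp add: poly2_op_diff poly2_op_monom)
qed

lemma poly2_op_w_minus: "poly2_op [:[:- b:], 1:] T1 T2 x = T2 x - b *\<^sub>C x"
proof -
  have "[:[:- b:], 1:] = monom (monom 1 0) 1 - monom (monom b 0) 0"
    by (simp add: monom_altdef one_pCons)
  then show ?thesis by (simp only: poly2_op_diff poly2_op_monom) simp
qed

end

section \<open>Spectral sets from polynomial approximation\<close>

lemma sup_norm_least: "0 \<le> M \<Longrightarrow> (\<And>x. x \<in> X \<Longrightarrow> cmod (f x) \<le> M) \<Longrightarrow> sup_norm X f \<le> M"
  unfolding sup_norm_def by (rule cSup_least) auto

lemma sup_norm_upper:
  assumes "bdd_above ((\<lambda>x. cmod (f x)) ` X)" "x \<in> X"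
  shows "cmod (f x) \<le> sup_norm X f"
  unfolding sup_norm_def using assms by (intro cSup_upper) auto

lemma sup_norm_nonneg:
  assumes "bdd_above ((\<lambda>x. cmod (f x)) ` X)"
  shows "0 \<le> sup_norm X f"
  unfolding sup_norm_def using assms by (intro cSup_upper) auto

lemma poly2_bounded:
  assumes "compact (closure V)"
  obtains M where "0 \<le> M" "\<And>x. x \<in> closure V \<Longrightarrow> cmod (poly2 p x) \<le> M"
proof -
  have "bounded (poly2 p ` closure V)"
    by (intro compact_imp_bounded compact_continuous_image continuous_on_poly2 assms)
  then show ?thesis using that unfolding bounded_pos by (metis image_eqI less_imp_le)
qed

lemma poly2_zero_split:
  assumes "poly2 q (a, b) = 0"
  obtains f g where "q = f * [:[:- a, 1:]:] + g * [:[:- b:], 1:]"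
proof -
  have "poly (q - [:poly q [:b:]:]) [:b:] = 0"
    by simp
  then have "[:- [:b:], 1:] dvd q - [:poly q [:b:]:]"
    by (simp only: poly_eq_0_iff_dvd)
  then obtain g where g: "q - [:poly q [:b:]:] = g * [:[:- b:], 1:]"
    by (auto elim!: dvdE simp: mult.commute)
  have "[:- a, 1:] dvd poly q [:b:]"
    using assms by (simp add: poly2_eq poly_eq_0_iff_dvd[symmetric])
  then obtain h where "poly q [:b:] = h * [:- a, 1:]"
    by (auto elim!: dvdE simp: mult.commute)
  then have "[:poly q [:b:]:] = [:h:] * [:[:- a, 1:]:]"
    by simp
  with g that show ?thesis
    by (metis add.commute diff_add_cancel)
qed

context
  fixes T1 T2 :: "'h::chilbert_space \<Rightarrow> 'h" and V :: "(complex \<times> complex) set"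
  assumes T1: "bounded_clinear T1" and T2: "bounded_clinear T2" and comm: "T1 \<circ> T2 = T2 \<circ> T1"
    and compact: "compact (closure V)"
    and vN: "\<And>p. onorm (poly2_op p T1 T2) \<le> sup_norm V (poly2 p)"
begin

private abbreviation op :: "complex poly poly \<Rightarrow> 'h \<Rightarrow> 'h" where "op p \<equiv> poly2_op p T1 T2"

lemmas op_simps =
  poly2_op_add[OF T1 T2 comm] poly2_op_diff[OF T1 T2 comm]
  poly2_op_mult[OF T1 T2 comm] poly2_op_one[OF T1 T2 comm] poly2_op_zero[OF T1 T2 comm]
lemmas op_clinear = bounded_clinear_poly2_op[OF T1 T2 comm]
lemmas op_linear = bounded_clinearD[OF op_clinear]

lemma norm_op_le:
  assumes "0 \<le> M" "\<And>x. x \<in> V \<Longrightarrow> cmod (poly2 p x) \<le> M"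
  shows "norm (op p x) \<le> M * norm x"
proof -
  have "norm (op p x) \<le> onorm (op p) * norm x"
    by (rule onorm[OF op_linear(1)])
  also have "\<dots> \<le> M * norm x"
    using order_trans[OF vN sup_norm_least[OF assms]] by (intro mult_right_mono) auto
  finally show ?thesis .
qed

text \<open>If polynomials \<open>u\<^sub>n\<close> converge to \<open>1/q\<close> uniformly on \<open>V\<close>, the von Neumann inequality makes
  \<open>u\<^sub>n(T\<^sub>1,T\<^sub>2)\<close> a Cauchy sequence in the operator norm; its limit is \<open>q(T\<^sub>1,T\<^sub>2)\<^sup>-\<^sup>1\<close>, and the
  inequality for \<open>p/q\<close> is the limit of the inequalities for \<open>p u\<^sub>n\<close>.\<close>

lemma inverse_of_approximable:
  assumes q: "\<And>x. x \<in> closure V \<Longrightarrow> poly2 q x \<noteq> 0"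
    and approx: "\<And>e. e > 0 \<Longrightarrow> \<exists>u. \<forall>x\<in>V. cmod (poly2 u x - 1 / poly2 q x) \<le> e"
  shows "\<exists>S. bounded_clinear S \<and> S \<circ> op q = id \<and> op q \<circ> S = id \<and>
    (\<forall>p. onorm (op p \<circ> S) \<le> sup_norm (closure V) (\<lambda>x. poly2 p x / poly2 q x))"
proof -
  define d where "d n = inverse (real (Suc n))" for n
  have d: "d n > 0" for n by (simp add: d_def)
  have d0: "d \<longlonglongrightarrow> 0" unfolding d_def by (rule LIMSEQ_inverse_real_of_nat)
  obtain u where u: "\<And>n x. x \<in> V \<Longrightarrow> cmod (poly2 (u n) x - 1 / poly2 q x) \<le> d n"
    using approx[OF d] by metis
  define A where "A n = Blinfun (op (u n))" for n
  have A: "blinfun_apply (A n) = op (u n)" for n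
    unfolding A_def by (rule bounded_linear_Blinfun_apply[OF op_linear(1)])
  have AA: "norm (A n - A k) \<le> d n + d k" for n k
  proof (rule norm_blinfun_bound)
    show "0 \<le> d n + d k" using d[of n] d[of k] by simp
    fix x
    have "norm (op (u n - u k) x) \<le> (d n + d k) * norm x"
    proof (rule norm_op_le)
      fix y assume "y \<in> V"
      then show "cmod (poly2 (u n - u k) y) \<le> d n + d k"
        using u[of y n] u[of y k] norm_triangle_ineq4[of "poly2 (u n) y - 1 / poly2 q y" "poly2 (u k) y - 1 / poly2 q y"]
        by simp
    qed fact
    then show "norm (blinfun_apply (A n - A k) x) \<le> (d n + d k) * norm x"
      by (simp add: blinfun.diff_left A op_simps)
  qed
  have "Cauchy A"
  proof (rule metric_CauchyI)
    fix e :: real assume "e > 0"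
    then have "eventually (\<lambda>n. d n < e / 2) sequentially"
      using d0 by (intro order_tendstoD(2)) auto
    then obtain N where N: "\<And>n. n \<ge> N \<Longrightarrow> d n < e / 2"
      by (auto simp: eventually_sequentially)
    show "\<exists>M. \<forall>m\<ge>M. \<forall>n\<ge>M. dist (A m) (A n) < e"
    proof (intro exI[of _ N] allI impI)
      fix m n assume "m \<ge> N" "n \<ge> N"
      then show "dist (A m) (A n) < e"
        using N[of m] N[of n] AA[of m n] by (simp add: dist_norm)
    qed
  qed
  then obtain L where L: "A \<longlonglongrightarrow> L"
    using Cauchy_convergent_iff convergent_def by blast
  define S where "S = blinfun_apply L"
  have S: "(\<lambda>n. op (u n) x) \<longlonglongrightarrow> S x" for x
    using blinfun.tendsto[OF L tendsto_const, of x] by (simp add: A S_def)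
  have pS: "(\<lambda>n. op p (op (u n) x)) \<longlonglongrightarrow> op p (S x)" for p x
    by (rule bounded_linear.tendsto[OF op_linear(1) S])
  have small: "cmod (poly2 (p * u n) y - poly2 p y / poly2 q y) \<le> M * d n"
    if "y \<in> V" "cmod (poly2 p y) \<le> M" for p M n y
  proof -
    have "cmod (poly2 (p * u n) y - poly2 p y / poly2 q y) =
        cmod (poly2 p y) * cmod (poly2 (u n) y - 1 / poly2 q y)"
      by (simp add: norm_mult[symmetric] right_diff_distrib)
    also have "\<dots> \<le> M * d n"
      using that u[of y n] by (intro mult_mono) (auto intro: order_trans[OF norm_ge_zero])
    finally show ?thesis .
  qed
  obtain Mq where Mq: "0 \<le> Mq" "\<And>x. x \<in> closure V \<Longrightarrow> cmod (poly2 q x) \<le> Mq"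
    using poly2_bounded[OF compact] by blast
  have qu: "(\<lambda>n. op q (op (u n) x)) \<longlonglongrightarrow> x" for x
  proof (rule LIM_zero_cancel)
    have bound: "norm (op q (op (u n) x) - x) \<le> Mq * d n * norm x" for n
    proof -
      have "norm (op (q * u n - 1) x) \<le> Mq * d n * norm x"
      proof (rule norm_op_le)
        show "0 \<le> Mq * d n" using Mq(1) d[of n] by simp
        fix y assume y: "y \<in> V"
        with closure_subset have y': "y \<in> closure V" by blast
        from small[OF y Mq(2)[OF y'], of n] q[OF y']
        show "cmod (poly2 (q * u n - 1) y) \<le> Mq * d n" by simp
      qed
      then show ?thesis by (simp add: op_simps)
    qed
    have "(\<lambda>n. Mq * d n * norm x) \<longlonglongrightarrow> Mq * 0 * norm x"
      by (intro tendsto_intros d0)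
    then have lim: "(\<lambda>n. Mq * d n * norm x) \<longlonglongrightarrow> 0"
      by simp
    show "(\<lambda>n. op q (op (u n) x) - x) \<longlonglongrightarrow> 0"
      by (rule Lim_null_comparison[OF always_eventually lim]) (use bound in blast)
  qed
  have "op q (S x) = x" for x
    using LIMSEQ_unique[OF pS qu] .
  moreover have "S (op q x) = x" for x
  proof (rule LIMSEQ_unique[OF S])
    have "op (u n) (op q x) = op q (op (u n) x)" for n
      by (metis op_simps(3) mult.commute)
    then show "(\<lambda>n. op (u n) (op q x)) \<longlonglongrightarrow> x" using qu by simp
  qed
  moreover have "bounded_clinear S"
    unfolding bounded_clinear_def
  proof (intro conjI allI)
    show "bounded_linear S" by (simp add: S_def blinfun.bounded_linear_right)
    fix c x
    have "(\<lambda>n. c *\<^sub>C op (u n) x) \<longlonglongrightarrow> c *\<^sub>C S x"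
      by (rule bounded_linear.tendsto[OF bounded_linear_scaleC S])
    then show "S (c *\<^sub>C x) = c *\<^sub>C S x"
      using S[of "c *\<^sub>C x"] by (simp add: op_linear(2) LIMSEQ_unique)
  qed
  moreover have "onorm (op p \<circ> S) \<le> sup_norm (closure V) (\<lambda>x. poly2 p x / poly2 q x)" (is "_ \<le> ?s") for p
  proof -
    have "compact ((\<lambda>x. cmod (poly2 p x / poly2 q x)) ` closure V)"
      using q by (intro compact_continuous_image continuous_intros compact) auto
    then have bdd: "bdd_above ((\<lambda>x. cmod (poly2 p x / poly2 q x)) ` closure V)"
      by (intro bounded_imp_bdd_above compact_imp_bounded)
    obtain M where M: "0 \<le> M" "\<And>x. x \<in> closure V \<Longrightarrow> cmod (poly2 p x) \<le> M"
      using poly2_bounded[OF compact] by blast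
    have bound: "norm (op p (op (u n) x)) \<le> (?s + M * d n) * norm x" for n and x :: 'h
    proof -
      have "norm (op (p * u n) x) \<le> (?s + M * d n) * norm x"
      proof (rule norm_op_le)
        show "0 \<le> ?s + M * d n" using sup_norm_nonneg[OF bdd] M(1) d[of n] by simp
        fix y assume y: "y \<in> V"
        with closure_subset have y': "y \<in> closure V" by blast
        have "cmod (poly2 (p * u n) y) \<le> cmod (poly2 p y / poly2 q y) + M * d n"
          using small[OF y M(2)[OF y'], of n] norm_triangle_sub by (smt (verit))
        then show "cmod (poly2 (p * u n) y) \<le> ?s + M * d n"
          using sup_norm_upper[OF bdd y'] by simp
      qed
      then show ?thesis by (simp add: op_simps)
    qed
    show ?thesis
    proof (rule onorm_bound[OF sup_norm_nonneg[OF bdd]])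
      fix x :: 'h
      have "(\<lambda>n. (?s + M * d n) * norm x) \<longlonglongrightarrow> (?s + M * 0) * norm x"
        by (intro tendsto_intros d0)
      then have "norm (op p (S x)) \<le> (?s + M * 0) * norm x"
        by (rule LIMSEQ_le[OF tendsto_norm[OF pS]]) (use bound in blast)
      then show "norm ((op p \<circ> S) x) \<le> ?s * norm x"
        by simp
    qed
  qed
  ultimately show ?thesis by (intro exI[of _ S]) (auto simp: fun_eq_iff)
qed

text \<open>A polynomial \<open>q\<close> vanishing at \<open>(a,b)\<close> is \<open>f (z - a) + g (w - b)\<close>. When \<open>q(T\<^sub>1,T\<^sub>2)\<close> is
  invertible, this is a Bezout identity for \<open>T\<^sub>1 - a\<close> and \<open>T\<^sub>2 - b\<close> with coefficients in
  their commutant, and it splits the Koszul complex.\<close>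

lemma koszul_exact_of_invertible:
  assumes q: "poly2 q (a, b) = 0"
    and S: "bounded_clinear S" "\<And>x. S (op q x) = x" "\<And>x. op q (S x) = x"
  shows "koszul_exact (\<lambda>x. T1 x - a *\<^sub>C x) (\<lambda>x. T2 x - b *\<^sub>C x)"
proof -
  obtain f g where fg: "q = f * [:[:- a, 1:]:] + g * [:[:- b:], 1:]"
    using poly2_zero_split[OF q] by blast
  define A where "A = op [:[:- a, 1:]:]"
  define B where "B = op [:[:- b:], 1:]"
  have AB: "(\<lambda>x. T1 x - a *\<^sub>C x) = A" "(\<lambda>x. T2 x - b *\<^sub>C x) = B"
    by (auto simp: A_def B_def poly2_op_z_minus[OF T1 T2 comm] poly2_op_w_minus[OF T1 T2 comm])
  have op_comm: "op p (op r x) = op r (op p x)" for p r x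
    by (metis op_simps(3) mult.commute)
  have S_comm: "S (op p x) = op p (S x)" for p x
    by (metis S(2,3) op_comm)
  have q_eq: "op q x = op f (A x) + op g (B x)" for x
    by (simp only: fg op_simps A_def B_def)
  have AS: "A (S x) = S (A x)" "B (S x) = S (B x)" for x
    by (simp_all add: A_def B_def S_comm)
  have comms: "A (op p x) = op p (A x)" "B (op p x) = op p (B x)" for p x
    by (simp_all add: A_def B_def op_comm)
  have lin: "A (x + y) = A x + A y" "B (x + y) = B x + B y" "B (0 - x) = 0 - B x" "A 0 = 0" "B 0 = 0" for x y
    by (simp_all only: A_def B_def op_linear)
  have "x = 0" if "A x = 0" "B x = 0" for x
  proof -
    have "op q x = 0" by (simp add: q_eq that op_linear)
    then have "x = S 0" using S(2)[of x] by simp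
    then show ?thesis by (simp add: bounded_clinearD[OF S(1)])
  qed
  moreover have "\<exists>z. x = A z \<and> y = B z" if xy: "A y = B x" for x y
  proof (intro exI conjI)
    have BA: "B (A v) = A (B v)" for v by (simp add: A_def B_def op_comm)
    let ?z = "S (op f x + op g y)"
    have "A ?z = S (op f (A x) + op g (A y))"
      by (simp add: AS lin comms)
    also have "\<dots> = x" by (simp add: xy q_eq[symmetric] S)
    finally show "x = A ?z" by simp
    have "B ?z = S (op f (B x) + op g (B y))"
      by (simp add: AS lin comms)
    also have "\<dots> = y" by (simp add: xy[symmetric] q_eq[symmetric] S)
    finally show "y = B ?z" by simp
  qed
  moreover have BA: "A (B v) = B (A v)" for v by (simp add: A_def B_def op_comm)
  moreover have "v \<in> range (\<lambda>(x, y). A y - B x)" for v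
  proof (rule range_eqI)
    have "v = op q (S v)" by (simp add: S)
    also have "\<dots> = A (op f (S v)) - B (0 - op g (S v))"
      by (simp only: q_eq lin comms) simp
    finally show "v = (\<lambda>(x, y). A y - B x) (0 - op g (S v), op f (S v))" by simp
  qed
  ultimately have "{x. (A x, B x) = (0, 0)} = {0}"
    "{(x, y). A y - B x = 0} = range (\<lambda>x. (A x, B x))"
    "range (\<lambda>(x, y). A y - B x) = UNIV"
    by (auto simp: lin image_iff)
  then show ?thesis
    unfolding koszul_exact_def AB by blast
qed

text \<open>The first hypothesis says that the polynomials are uniformly dense in the rational functions with
  poles off the closure of \<open>V\<close>, the second that this closure is rationally convex.\<close>

lemma spectral_set_closureI:
  assumes approx: "\<And>q e. (\<And>x. x \<in> closure V \<Longrightarrow> poly2 q x \<noteq> 0) \<Longrightarrow> e > 0 \<Longrightarrow>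
      \<exists>u. \<forall>x\<in>V. cmod (poly2 u x - 1 / poly2 q x) \<le> e"
    and convex: "\<And>a b. (a, b) \<notin> closure V \<Longrightarrow>
      \<exists>q. poly2 q (a, b) = 0 \<and> (\<forall>x\<in>closure V. poly2 q x \<noteq> 0)"
  shows "spectral_set (closure V) T1 T2"
proof -
  have inv: "\<exists>S. bounded_clinear S \<and> S \<circ> op q = id \<and> op q \<circ> S = id \<and>
    (\<forall>p. onorm (op p \<circ> S) \<le> sup_norm (closure V) (\<lambda>x. poly2 p x / poly2 q x))"
    if "\<forall>x\<in>closure V. poly2 q x \<noteq> 0" for q
    using that approx by (intro inverse_of_approximable) auto
  have "koszul_exact (\<lambda>x. T1 x - a *\<^sub>C x) (\<lambda>x. T2 x - b *\<^sub>C x)" if "(a, b) \<notin> closure V" for a b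
  proof -
    obtain q where q: "poly2 q (a, b) = 0" "\<forall>x\<in>closure V. poly2 q x \<noteq> 0"
      using convex \<open>(a, b) \<notin> closure V\<close> by blast
    obtain S where "bounded_clinear S" "S \<circ> op q = id" "op q \<circ> S = id"
      using inv[OF q(2)] by blast
    then show ?thesis
      by (intro koszul_exact_of_invertible[OF q(1)]) (auto dest: pointfree_idE)
  qed
  then have "taylor_spectrum T1 T2 \<subseteq> closure V"
    unfolding taylor_spectrum_def by blast
  then show ?thesis
    unfolding spectral_set_def using compact inv by blast
qed

end

section \<open>Elimination of one variable\<close>

text \<open>Over a point \<open>a\<close> where \<open>Q\<close> and \<open>q\<close> have no common zero, \<open>Q(a,\<cdot>)\<close> and \<open>q(a,\<cdot>)\<close> are coprime,
  so every relation between them is a multiple of the trivial one. If \<open>\<alpha> Q + \<beta> q = 1\<close> on the fibre,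
  the multiplier is \<open>\<alpha> v - \<beta> u\<close>.\<close>

lemma relation_at_coprime_fibre:
  assumes "\<And>w. poly2 Q (a, w) \<noteq> 0 \<or> poly2 q (a, w) \<noteq> 0"
    and rel: "\<And>w. poly2 u (a, w) * poly2 Q (a, w) + poly2 v (a, w) * poly2 q (a, w) = 0"
  obtains h where "\<And>w. poly2 u (a, w) = - poly2 h (a, w) * poly2 q (a, w)"
    "\<And>w. poly2 v (a, w) = poly2 h (a, w) * poly2 Q (a, w)"
proof -
  let ?e = "\<lambda>p. map_poly (\<lambda>c. poly c a) p"
  have e: "poly2 p (a, w) = poly (?e p) w" for p w by (rule poly2_eq_poly_map_poly)
  have "coprime (?e Q) (?e q)"
  proof (rule coprimeI)
    fix d assume d: "d dvd ?e Q" "d dvd ?e q"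
    show "is_unit d"
    proof (rule ccontr)
      assume "\<not> is_unit d"
      have "\<exists>w. poly d w = 0"
      proof (cases "d = 0")
        case False
        with \<open>\<not> is_unit d\<close> have "degree d > 0"
          by (simp add: is_unit_iff_degree)
        then show ?thesis
          using alg_closed_imp_poly_has_root by blast
      qed simp
      then obtain w where "poly d w = 0" by blast
      with d have "poly (?e Q) w = 0" "poly (?e q) w = 0" by (auto elim!: dvdE)
      with assms(1)[of w] show False by (simp add: e)
    qed
  qed
  then obtain \<alpha> \<beta> where bez: "\<alpha> * ?e Q + \<beta> * ?e q = 1"
    using bezout_coefficients_fst_snd[of "?e Q" "?e q"] by (auto simp: coprime_iff_gcd_eq_1)
  define h where "h = map_poly (\<lambda>c. [:c:]) (\<alpha> * ?e v - \<beta> * ?e u)"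
  have "?e h = \<alpha> * ?e v - \<beta> * ?e u"
    by (simp add: h_def map_poly_map_poly comp_def)
  then have h: "poly2 h (a, w) = poly \<alpha> w * poly2 v (a, w) - poly \<beta> w * poly2 u (a, w)" for w
    by (simp add: e)
  have bez': "poly \<alpha> w * poly2 Q (a, w) + poly \<beta> w * poly2 q (a, w) = 1" for w
    using arg_cong[OF bez, of "\<lambda>p. poly p w"] by (simp add: e)
  show ?thesis
  proof (rule that)
    fix w
    show "poly2 u (a, w) = - poly2 h (a, w) * poly2 q (a, w)"
      unfolding h using bez'[of w] rel[of w] by algebra
    show "poly2 v (a, w) = poly2 h (a, w) * poly2 Q (a, w)"
      unfolding h using bez'[of w] rel[of w] by algebra
  qed
qed

lemma poly2_vanishing_fibre:
  assumes "\<And>w. poly2 p (a, w) = 0"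
  obtains p' where "p = smult [:- a, 1:] p'"
proof -
  have "map_poly (\<lambda>c. poly c a) p = 0"
    using assms by (subst poly_eq_poly_eq_iff[symmetric]) (auto simp: poly2_eq_poly_map_poly fun_eq_iff)
  then have "poly (coeff p n) a = 0" for n
    by (metis coeff_0 coeff_map_poly poly_0)
  then have "[:[:- a, 1:]:] dvd p"
    by (simp add: const_poly_dvd_iff poly_eq_0_iff_dvd)
  with that show ?thesis by (auto elim!: dvdE)
qed

text \<open>A nonzero element \<open>g\<close> of least \<open>w\<close>-degree in the ideal divides multiples \<open>a(z) Q\<close> and
  \<open>b(z) q\<close>. If \<open>g\<close> involved \<open>w\<close>, then for all but finitely many \<open>z\<close> it would have a zero
  over \<open>z\<close>, and this would be a common zero of \<open>Q\<close> and \<open>q\<close>.\<close>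

lemma nonzero_eliminant:
  fixes Q q :: "complex poly poly"
  assumes "infinite K" and nz: "\<And>z w. z \<in> K \<Longrightarrow> poly2 Q (z, w) \<noteq> 0 \<or> poly2 q (z, w) \<noteq> 0"
  obtains u v \<rho> where "u * Q + v * q = [:\<rho>:]" "\<rho> \<noteq> 0"
proof -
  define J where "J = {u * Q + v * q | u v. True}"
  have QJ: "Q \<in> J" and qJ: "q \<in> J"
    unfolding J_def using mult_1 mult_zero_left add_0_left add_0_right by (smt (verit) mem_Collect_eq)+
  have Jdiff: "x * p - y * r \<in> J" if "p \<in> J" "r \<in> J" for x y p r
  proof -
    obtain u v u' v' where "p = u * Q + v * q" "r = u' * Q + v' * q"
      using \<open>p \<in> J\<close> \<open>r \<in> J\<close> unfolding J_def by blast
    then have "x * p - y * r = (x * u - y * u') * Q + (x * v - y * v') * q"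
      by (simp add: algebra_simps)
    then show ?thesis unfolding J_def by blast
  qed
  obtain z0 where "z0 \<in> K" using \<open>infinite K\<close> by fastforce
  then have "Q \<noteq> 0 \<or> q \<noteq> 0" using nz[of z0 0] by auto
  then have "\<exists>g. g \<in> J \<and> g \<noteq> 0" using QJ qJ by blast
  then obtain g where g: "g \<in> J" "g \<noteq> 0" and least: "\<And>p. p \<in> J \<Longrightarrow> p \<noteq> 0 \<Longrightarrow> degree g \<le> degree p"
    using ex_has_least_nat[of "\<lambda>g. g \<in> J \<and> g \<noteq> 0" _ degree] by metis
  have divides: "\<exists>a s. a \<noteq> 0 \<and> smult a p = g * s" if "p \<in> J" for p
  proof -
    obtain a s where as: "a \<noteq> 0" "smult a p = g * s + pseudo_mod p g"
      using pseudo_mod(1)[OF g(2)] by blast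
    then have "pseudo_mod p g = [:a:] * p - s * g" by (simp add: algebra_simps)
    then have "pseudo_mod p g \<in> J" using Jdiff[OF that g(1)] by metis
    then have "pseudo_mod p g = 0"
      using least pseudo_mod(2)[OF g(2), of p] by fastforce
    with as show ?thesis by auto
  qed
  obtain a s where as: "a \<noteq> 0" "smult a Q = g * s" using divides[OF QJ] by blast
  obtain b t where bt: "b \<noteq> 0" "smult b q = g * t" using divides[OF qJ] by blast
  have "degree g = 0"
  proof (rule ccontr)
    assume deg: "degree g \<noteq> 0"
    let ?c = "a * b * lead_coeff g"
    have "?c \<noteq> 0" using as(1) bt(1) g(2) by simp
    then have "finite {z. poly ?c z = 0}" by (rule poly_roots_finite)
    then obtain z where "z \<in> K" and z: "poly ?c z \<noteq> 0"
      using \<open>infinite K\<close> by (metis (mono_tags, lifting) finite_subset mem_Collect_eq subsetI)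
    let ?e = "map_poly (\<lambda>c. poly c z)"
    have "coeff (?e g) (degree g) \<noteq> 0"
      using z by (simp add: coeff_map_poly)
    then have "degree (?e g) > 0"
      using deg le_degree by fastforce
    then obtain w where "poly (?e g) w = 0"
      using alg_closed_imp_poly_has_root by blast
    then have g0: "poly2 g (z, w) = 0" by (simp add: poly2_eq_poly_map_poly)
    have "poly2 ([:a:] * Q) (z, w) = 0" "poly2 ([:b:] * q) (z, w) = 0"
      using as(2) bt(2) g0 by simp_all
    then have "poly2 Q (z, w) = 0" "poly2 q (z, w) = 0"
      using z unfolding poly2_simps poly2_const by auto
    with nz[OF \<open>z \<in> K\<close>] show False by blast
  qed
  then obtain \<rho> where \<rho>: "g = [:\<rho>:]" by (rule degree_eq_zeroE)
  obtain u v where "g = u * Q + v * q" using g(1) unfolding J_def by blast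
  with \<rho> g(2) show ?thesis by (intro that[of u v \<rho>]) auto
qed

text \<open>If the eliminant of least degree vanished at \<open>a \<in> K\<close>, the relation it induces on the fibre over
  \<open>a\<close> would be trivial; correcting the coefficients by that trivial relation makes them divisible
  by \<open>z - a\<close>, and cancelling this factor lowers the degree.\<close>

lemma eliminant_without_zeros:
  fixes Q q :: "complex poly poly"
  assumes "infinite K" and nz: "\<And>z w. z \<in> K \<Longrightarrow> poly2 Q (z, w) \<noteq> 0 \<or> poly2 q (z, w) \<noteq> 0"
  obtains u v \<rho> where "u * Q + v * q = [:\<rho>:]" "\<And>z. z \<in> K \<Longrightarrow> poly \<rho> z \<noteq> 0"
proof -
  let ?P = "\<lambda>\<rho>. \<rho> \<noteq> 0 \<and> (\<exists>u v. u * Q + v * q = [:\<rho>:])"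
  have "\<exists>\<rho>. ?P \<rho>" using nonzero_eliminant[OF assms] by metis
  then obtain \<rho> where \<rho>: "?P \<rho>" and least: "\<And>\<rho>'. ?P \<rho>' \<Longrightarrow> degree \<rho> \<le> degree \<rho>'"
    using ex_has_least_nat[of ?P _ degree] by metis
  then obtain u v where uv: "u * Q + v * q = [:\<rho>:]" by blast
  have "poly \<rho> a \<noteq> 0" if "a \<in> K" for a
  proof
    assume zero: "poly \<rho> a = 0"
    have "poly2 u (a, w) * poly2 Q (a, w) + poly2 v (a, w) * poly2 q (a, w) = 0" for w
      using arg_cong[OF uv, of "\<lambda>p. poly2 p (a, w)"] zero by simp
    then obtain h where h: "\<And>w. poly2 u (a, w) = - poly2 h (a, w) * poly2 q (a, w)"
      "\<And>w. poly2 v (a, w) = poly2 h (a, w) * poly2 Q (a, w)"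
      using relation_at_coprime_fibre[OF nz[OF \<open>a \<in> K\<close>]] by metis
    obtain u' where u': "u + h * q = smult [:- a, 1:] u'"
      using poly2_vanishing_fibre[of "u + h * q" a] by (auto simp: h)
    obtain v' where v': "v - h * Q = smult [:- a, 1:] v'"
      using poly2_vanishing_fibre[of "v - h * Q" a] by (auto simp: h)
    obtain \<rho>' where \<rho>': "\<rho> = [:- a, 1:] * \<rho>'"
      using zero by (auto simp: poly_eq_0_iff_dvd elim!: dvdE)
    have "[:\<rho>:] = (u + h * q) * Q + (v - h * Q) * q"
      by (simp add: uv[symmetric] algebra_simps)
    also have "\<dots> = smult [:- a, 1:] (u' * Q + v' * q)"
      by (simp only: u' v' mult_smult_left smult_add_right)
    finally have "smult [:- a, 1:] (u' * Q + v' * q) = smult [:- a, 1:] [:\<rho>':]"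
      by (simp add: \<rho>')
    then have "smult [:- a, 1:] (u' * Q + v' * q - [:\<rho>':]) = 0"
      by (simp only: smult_diff_right diff_self)
    moreover have "[:- a, 1:] \<noteq> 0" by simp
    ultimately have "u' * Q + v' * q = [:\<rho>':]"
      by (simp only: smult_eq_0_iff) simp
    moreover have "\<rho>' \<noteq> 0" using \<rho> \<rho>' by auto
    ultimately have "degree \<rho> \<le> degree \<rho>'" using least by blast
    moreover have "degree \<rho> = Suc (degree \<rho>')"
      unfolding \<rho>' using \<open>\<rho>' \<noteq> 0\<close> by (subst degree_mult_eq) auto
    ultimately show False by simp
  qed
  with uv that show ?thesis by blast
qed

text \<open>The Taylor polynomials converge uniformly, because the roots of \<open>\<rho>\<close> stay away from the
  closed disc.\<close>

lemma approx_inverse_poly: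
  assumes "\<And>z. cmod z \<le> 1 \<Longrightarrow> poly \<rho> z \<noteq> 0" "e > 0"
  shows "\<exists>g. \<forall>z\<in>cball 0 1. cmod (poly g z - 1 / poly \<rho> z) < e"
proof -
  let ?f = "\<lambda>z. 1 / poly \<rho> z"
  \<comment> \<open>The \<open>2\<close> gives a radius also when \<open>\<rho>\<close> is constant.\<close>
  define R where "R = Min (insert 2 (cmod ` {z. poly \<rho> z = 0}))"
  have "\<rho> \<noteq> 0" using assms(1)[of 0] by auto
  then have fin: "finite (cmod ` {z. poly \<rho> z = 0})" by (simp add: poly_roots_finite)
  have "R > 1"
    unfolding R_def using fin assms(1) by (subst Min_gr_iff) (auto simp: not_le[symmetric])
  have "R \<le> cmod z" if "poly \<rho> z = 0" for z
    unfolding R_def using fin that by (intro Min_le) auto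
  then have hol: "?f holomorphic_on ball 0 R"
    by (intro holomorphic_intros) (auto simp: not_le[symmetric])
  define a where "a n = (deriv ^^ n) ?f 0 / fact n" for n
  have sums: "(\<lambda>n. a n * z ^ n) sums ?f z" if "z \<in> ball 0 R" for z
    using holomorphic_power_series[OF hol that] by (simp add: a_def)
  have "conv_radius a \<ge> R"
  proof (rule conv_radius_geI_ex)
    fix r :: real assume "0 < r" "ereal r < ereal R"
    then show "\<exists>z. norm z = r \<and> summable (\<lambda>n. a n * z ^ n)"
      using sums by (intro exI[of _ "of_real r"]) (auto simp: sums_iff)
  qed
  then have "ereal 1 < conv_radius a"
    using \<open>R > 1\<close> by (metis ereal_less_eq(3) less_ereal.simps(1) less_le_trans)
  from powser_uniform_limit[OF this, of 0]
  have "uniform_limit (cball 0 1) (\<lambda>n z. \<Sum>i<n. a i * z ^ i) (\<lambda>z. \<Sum>i. a i * z ^ i) sequentially"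
    by simp
  from uniform_limitD[OF this \<open>e > 0\<close>]
  obtain n where n: "\<And>z. z \<in> cball 0 1 \<Longrightarrow> cmod ((\<Sum>i<n. a i * z ^ i) - (\<Sum>i. a i * z ^ i)) < e"
    unfolding eventually_sequentially dist_norm by blast
  have "cmod (poly (\<Sum>i<n. monom (a i) i) z - ?f z) < e" if "z \<in> cball 0 1" for z
    using n[OF that] sums[of z] that \<open>R > 1\<close> by (simp add: sums_iff poly_sum poly_monom)
  then show ?thesis by blast
qed

text \<open>On the curve \<open>Q = 0\<close> the eliminant reads \<open>v q = \<rho>\<close>, so that \<open>1/q = v/\<rho>\<close> there.\<close>

lemma approx_inverse_on_curve:
  assumes Q: "\<And>x. x \<in> X \<Longrightarrow> poly2 Q x = 0"
    and X: "X \<subseteq> cball 0 1 \<times> UNIV" "compact X"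
    and q: "\<And>z w. cmod z \<le> 1 \<Longrightarrow> poly2 Q (z, w) = 0 \<Longrightarrow> poly2 q (z, w) \<noteq> 0"
    and "e > 0"
  shows "\<exists>u. \<forall>x\<in>X. cmod (poly2 u x - 1 / poly2 q x) \<le> e"
proof -
  have "infinite (cball 0 1 :: complex set)"
    using uncountable_cball[of 1 "0::complex"] countable_finite by auto
  then obtain u v \<rho> where uv: "u * Q + v * q = [:\<rho>:]"
    and \<rho>: "\<And>z. z \<in> cball 0 1 \<Longrightarrow> poly \<rho> z \<noteq> 0"
    using eliminant_without_zeros[of "cball 0 1" Q q] q by (auto simp: dist_norm)
  have "bounded (poly2 v ` X)"
    by (intro compact_imp_bounded compact_continuous_image continuous_on_poly2 X)
  then obtain M where M: "M > 0" "\<And>x. x \<in> X \<Longrightarrow> cmod (poly2 v x) \<le> M"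
    unfolding bounded_pos by blast
  have "\<exists>g. \<forall>z\<in>cball 0 1. cmod (poly g z - 1 / poly \<rho> z) < e / M"
    using \<rho> M(1) \<open>e > 0\<close> by (intro approx_inverse_poly) auto
  then obtain g where g: "\<And>z. z \<in> cball 0 1 \<Longrightarrow> cmod (poly g z - 1 / poly \<rho> z) < e / M"
    by blast
  have "cmod (poly2 (v * [:g:]) x - 1 / poly2 q x) \<le> e" if "x \<in> X" for x
  proof -
    obtain z w where x: "x = (z, w)" by (cases x)
    have z: "z \<in> cball 0 1" using that X(1) by (auto simp: x)
    have q0: "poly2 q x \<noteq> 0" using q[of z w] Q[OF that] z by (simp add: x)
    have "poly2 v x * poly2 q x = poly \<rho> z"
      using arg_cong[OF uv, of "\<lambda>p. poly2 p x"] Q[OF that] by (simp add: x)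
    then have "1 / poly2 q x = poly2 v x * (1 / poly \<rho> z)"
      using q0 \<rho>[OF z] by (simp add: field_simps)
    moreover have "poly2 (v * [:g:]) x = poly2 v x * poly g z"
      by (simp only: x poly2_simps poly2_const)
    ultimately have "poly2 (v * [:g:]) x - 1 / poly2 q x = poly2 v x * (poly g z - 1 / poly \<rho> z)"
      by (simp only: right_diff_distrib)
    also have "cmod \<dots> \<le> M * (e / M)"
      unfolding norm_mult using M(2)[OF that] g[OF z] M(1) by (intro mult_mono) auto
    finally show ?thesis using M(1) by simp
  qed
  then show ?thesis by blast
qed

section \<open>Holomorphic functions with symmetric boundary values\<close>

text \<open>No boundary values are assumed to exist, so statements about the unit circle are made along
  the filter of points of the disc that approach it, uniformly in the argument.\<close>

definition at_circle :: "complex filter" where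
  "at_circle = filtercomap cmod (at_left 1)"

lemma eventually_at_circle:
  "eventually P at_circle \<longleftrightarrow> (\<exists>r. 0 < r \<and> r < 1 \<and> (\<forall>z. r < cmod z \<longrightarrow> cmod z < 1 \<longrightarrow> P z))"
proof
  assume "eventually P at_circle"
  then obtain b where b: "b < 1" "\<And>z. b < cmod z \<Longrightarrow> cmod z < 1 \<Longrightarrow> P z"
    by (auto simp: at_circle_def eventually_filtercomap eventually_at_left_field)
  then show "\<exists>r. 0 < r \<and> r < 1 \<and> (\<forall>z. r < cmod z \<longrightarrow> cmod z < 1 \<longrightarrow> P z)"
    by (intro exI[of _ "max b (1/2)"]) auto
next
  assume "\<exists>r. 0 < r \<and> r < 1 \<and> (\<forall>z. r < cmod z \<longrightarrow> cmod z < 1 \<longrightarrow> P z)"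
  then obtain r where "r < 1" "\<And>z. r < cmod z \<Longrightarrow> cmod z < 1 \<Longrightarrow> P z" by blast
  then show "eventually P at_circle"
    unfolding at_circle_def eventually_filtercomap eventually_at_left_field
    by (intro exI[of _ "\<lambda>x. r < x \<and> x < 1"]) auto
qed

lemma at_circle_in_disc: "eventually (\<lambda>z. z \<in> \<bbbD>) at_circle"
  by (auto simp: eventually_at_circle intro!: exI[of _ "1/2"])

lemma cmod_tendsto_at_circle: "(cmod \<longlongrightarrow> 1) at_circle"
proof -
  have "filterlim cmod (at_left 1) at_circle"
    unfolding at_circle_def by (rule filterlim_filtercomap)
  then show ?thesis
    by (rule filterlim_mono) (auto simp: at_within_def)
qed

lemma bounded_mult_null_at_circle:
  fixes f g :: "complex \<Rightarrow> complex"
  assumes "(f \<longlongrightarrow> 0) at_circle" "\<And>z. z \<in> \<bbbD> \<Longrightarrow> cmod (g z) \<le> M"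
  shows "((\<lambda>z. g z * f z) \<longlongrightarrow> 0) at_circle"
proof (rule Lim_null_comparison)
  show "eventually (\<lambda>z. norm (g z * f z) \<le> M * norm (f z)) at_circle"
    using at_circle_in_disc
    by eventually_elim (auto simp: norm_mult assms(2) intro!: mult_right_mono)
  show "((\<lambda>z. M * norm (f z)) \<longlongrightarrow> 0) at_circle"
    using tendsto_mult_right_zero[OF tendsto_norm_zero[OF assms(1)]] .
qed

lemma bounded_poly_disc: "\<exists>M. \<forall>z\<in>\<bbbD>. cmod (poly p z) \<le> M"
proof -
  have "bounded (poly p ` cball 0 1)"
    by (intro compact_imp_bounded compact_continuous_image continuous_intros) auto
  then obtain M where "\<forall>z\<in>cball 0 1. cmod (poly p z) \<le> M"
    by (auto simp: bounded_iff)
  then show ?thesis by (intro exI[of _ M]) auto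
qed

lemma cmod_le_one_of_circle:
  assumes "f holomorphic_on \<bbbD>" "((\<lambda>z. cmod (f z)) \<longlongrightarrow> 1) at_circle" "z \<in> \<bbbD>"
  shows "cmod (f z) \<le> 1"
proof (rule field_le_epsilon)
  fix e :: real assume "e > 0"
  then have "eventually (\<lambda>z. cmod (f z) < 1 + e) at_circle"
    using order_tendstoD(2)[OF assms(2), of "1 + e"] by simp
  then obtain r where r: "r < 1" "\<And>z. r < cmod z \<Longrightarrow> cmod z < 1 \<Longrightarrow> cmod (f z) < 1 + e"
    by (auto simp: eventually_at_circle)
  obtain s where s: "max r (cmod z) < s" "s < 1"
    using dense[of "max r (cmod z)" 1] r(1) assms(3) by auto
  have "0 < s" using s(1) norm_ge_zero[of z] by linarith
  have sub: "cball 0 s \<subseteq> \<bbbD>" using s(2) by auto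
  show "cmod (f z) \<le> 1 + e"
  proof (rule maximum_modulus_frontier[of f "cball 0 s" _ z])
    show "f holomorphic_on interior (cball 0 s)"
      using sub interior_subset by (intro holomorphic_on_subset[OF assms(1)]) blast
    show "continuous_on (closure (cball 0 s)) f"
      using sub by (intro holomorphic_on_imp_continuous_on holomorphic_on_subset[OF assms(1)]) simp
    show "cmod (f w) \<le> 1 + e" if "w \<in> frontier (cball 0 s)" for w
      using that s r(2)[of w] \<open>0 < s\<close> by (simp add: frontier_def)
  qed (use s in auto)
qed

lemma constant_of_circle_no_zero:
  assumes "f holomorphic_on \<bbbD>" "((\<lambda>z. cmod (f z)) \<longlongrightarrow> 1) at_circle"
    and "\<And>z. z \<in> \<bbbD> \<Longrightarrow> f z \<noteq> 0"
  obtains c where "cmod c = 1" "\<And>z. z \<in> \<bbbD> \<Longrightarrow> f z = c"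
proof -
  have "cmod (1 / f z) \<le> 1" if "z \<in> \<bbbD>" for z
  proof (rule cmod_le_one_of_circle[OF _ _ that])
    show "(\<lambda>z. 1 / f z) holomorphic_on \<bbbD>" using assms by (intro holomorphic_intros) auto
    have "((\<lambda>z. 1 / cmod (f z)) \<longlongrightarrow> 1 / 1) at_circle" by (intro tendsto_intros assms) auto
    then show "((\<lambda>z. cmod (1 / f z)) \<longlongrightarrow> 1) at_circle" by (simp add: norm_divide)
  qed
  then have one: "cmod (f z) = 1" if "z \<in> \<bbbD>" for z
    using cmod_le_one_of_circle[OF assms(1,2) that] that assms(3)[OF that]
    by (force simp: norm_divide divide_le_eq)
  have "f constant_on \<bbbD>"
    by (rule maximum_modulus_principle[OF assms(1), of "\<bbbD>" 0]) (auto simp: one)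
  then obtain c where "\<And>z. z \<in> \<bbbD> \<Longrightarrow> f z = c" by (auto simp: constant_on_def)
  with one[of 0] that show ?thesis by simp
qed

lemma blaschke_identity:
  "(cmod (1 - cnj \<alpha> * z))\<^sup>2 - (cmod (z - \<alpha>))\<^sup>2 = (1 - (cmod z)\<^sup>2) * (1 - (cmod \<alpha>)\<^sup>2)"
proof -
  have "complex_of_real ((cmod (1 - cnj \<alpha> * z))\<^sup>2 - (cmod (z - \<alpha>))\<^sup>2) =
      complex_of_real ((1 - (cmod z)\<^sup>2) * (1 - (cmod \<alpha>)\<^sup>2))"
    by (simp only: of_real_diff of_real_mult of_real_1 complex_norm_square) (simp add: algebra_simps)
  then show ?thesis by (simp only: of_real_eq_iff)
qed

lemma blaschke_denom: "cmod \<alpha> < 1 \<Longrightarrow> cmod z \<le> 1 \<Longrightarrow> 1 - cnj \<alpha> * z \<noteq> 0"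
proof
  assume *: "cmod \<alpha> < 1" "cmod z \<le> 1" "1 - cnj \<alpha> * z = 0"
  then have "cmod \<alpha> * cmod z = 1" by (metis complex_mod_cnj eq_iff_diff_eq_0 norm_mult norm_one)
  moreover have "cmod \<alpha> * cmod z \<le> cmod \<alpha> * 1" using * by (intro mult_left_mono) auto
  ultimately show False using * by simp
qed

lemma blaschke_lt_one:
  assumes "cmod \<alpha> < 1" "cmod z < 1"
  shows "cmod (z - \<alpha>) < cmod (1 - cnj \<alpha> * z)"
proof -
  have "(1 - (cmod z)\<^sup>2) * (1 - (cmod \<alpha>)\<^sup>2) > 0"
    using assms by (intro mult_pos_pos) (auto simp: power_less_one_iff)
  then show ?thesis
    using blaschke_identity[of \<alpha> z] by (smt (verit) norm_ge_zero power_mono)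
qed

lemma blaschke_tendsto_one:
  assumes "cmod \<alpha> < 1"
  shows "((\<lambda>z. cmod (z - \<alpha>) / cmod (1 - cnj \<alpha> * z)) \<longlongrightarrow> 1) at_circle"
proof -
  let ?b = "\<lambda>z. cmod (z - \<alpha>) / cmod (1 - cnj \<alpha> * z)"
  have "((\<lambda>z. 1 - (?b z)\<^sup>2) \<longlongrightarrow> 0) at_circle"
  proof (rule Lim_null_comparison)
    show "eventually (\<lambda>z. norm (1 - (?b z)\<^sup>2) \<le> (1 - (cmod z)\<^sup>2) / (1 - cmod \<alpha>)\<^sup>2) at_circle"
      using at_circle_in_disc
    proof eventually_elim
      case (elim z)
      then have z: "cmod z < 1" by simp
      let ?d = "cmod (1 - cnj \<alpha> * z)"
      have d0: "?d > 0" using blaschke_denom[OF assms, of z] z by simp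
      have "1 - cmod \<alpha> \<le> 1 - cmod \<alpha> * cmod z"
        using mult_left_le[of "cmod z" "cmod \<alpha>"] z by simp
      also have "\<dots> \<le> ?d" using norm_triangle_ineq2[of 1 "cnj \<alpha> * z"] by (simp add: norm_mult)
      finally have d: "(1 - cmod \<alpha>)\<^sup>2 \<le> ?d\<^sup>2" using assms by (intro power_mono) auto
      have "1 - (?b z)\<^sup>2 = (1 - (cmod z)\<^sup>2) * (1 - (cmod \<alpha>)\<^sup>2) / ?d\<^sup>2"
        using d0 blaschke_identity[of \<alpha> z] by (simp add: power_divide field_simps)
      moreover have "\<dots> \<le> (1 - (cmod z)\<^sup>2) * 1 / (1 - cmod \<alpha>)\<^sup>2"
        using z assms d by (intro frac_le mult_left_mono) (auto simp: power_le_one)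
      moreover have "0 \<le> (1 - (cmod z)\<^sup>2) * (1 - (cmod \<alpha>)\<^sup>2) / ?d\<^sup>2"
        using z assms by (intro divide_nonneg_nonneg mult_nonneg_nonneg) (auto simp: power_le_one)
      ultimately show ?case by simp
    qed
    have "((\<lambda>z. (1 - (cmod z)\<^sup>2) / (1 - cmod \<alpha>)\<^sup>2) \<longlongrightarrow> (1 - 1\<^sup>2) / (1 - cmod \<alpha>)\<^sup>2) at_circle"
      using assms by (intro tendsto_intros cmod_tendsto_at_circle) auto
    then show "((\<lambda>z. (1 - (cmod z)\<^sup>2) / (1 - cmod \<alpha>)\<^sup>2) \<longlongrightarrow> 0) at_circle" by simp
  qed
  then have "((\<lambda>z. sqrt (1 - (1 - (?b z)\<^sup>2))) \<longlongrightarrow> sqrt (1 - 0)) at_circle"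
    by (intro tendsto_intros)
  then show ?thesis by (simp add: real_sqrt_abs)
qed

text \<open>The modulus of the Blaschke factor \<open>(z - \<alpha>) / (1 - cnj \<alpha> * z)\<close> tends to \<open>1\<close> at the circle, so
  dividing by it removes a zero and keeps the boundary behaviour.\<close>

lemma divide_blaschke_factor:
  assumes hol: "\<phi> holomorphic_on \<bbbD>" and lim: "((\<lambda>z. cmod (\<phi> z)) \<longlongrightarrow> 1) at_circle"
    and \<alpha>: "\<alpha> \<in> \<bbbD>" "\<phi> \<alpha> = 0"
  obtains \<phi>' where "\<phi>' holomorphic_on \<bbbD>" "((\<lambda>z. cmod (\<phi>' z)) \<longlongrightarrow> 1) at_circle"
    "\<And>z. z \<in> \<bbbD> \<Longrightarrow> \<phi> z * (1 - cnj \<alpha> * z) = (z - \<alpha>) * \<phi>' z"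
proof -
  define g where "g z = (if z = \<alpha> then deriv \<phi> \<alpha> else (\<phi> z - \<phi> \<alpha>) / (z - \<alpha>))" for z
  have g: "g holomorphic_on \<bbbD>"
    unfolding g_def by (rule pole_lemma_open[OF hol]) simp
  have fact: "\<phi> z = (z - \<alpha>) * g z" for z
    using \<alpha>(2) by (simp add: g_def)
  define \<phi>' where "\<phi>' z = (1 - cnj \<alpha> * z) * g z" for z
  have "((\<lambda>z. cmod (\<phi> z) / (cmod (z - \<alpha>) / cmod (1 - cnj \<alpha> * z))) \<longlongrightarrow> 1 / 1) at_circle"
    using \<alpha>(1) by (intro tendsto_divide lim blaschke_tendsto_one) auto
  moreover have "eventually (\<lambda>z. cmod (\<phi> z) / (cmod (z - \<alpha>) / cmod (1 - cnj \<alpha> * z)) = cmod (\<phi>' z)) at_circle"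
  proof -
    have "eventually (\<lambda>z. cmod z > cmod \<alpha>) at_circle"
      using order_tendstoD(1)[OF cmod_tendsto_at_circle, of "cmod \<alpha>"] \<alpha>(1) by simp
    then show ?thesis
    proof eventually_elim
      case (elim z)
      then have "z \<noteq> \<alpha>" by auto
      then show ?case by (simp add: fact \<phi>'_def norm_mult)
    qed
  qed
  ultimately have "((\<lambda>z. cmod (\<phi>' z)) \<longlongrightarrow> 1 / 1) at_circle"
    by (rule Lim_transform_eventually)
  then have "((\<lambda>z. cmod (\<phi>' z)) \<longlongrightarrow> 1) at_circle"
    by simp
  moreover have "\<phi>' holomorphic_on \<bbbD>"
    unfolding \<phi>'_def by (intro holomorphic_intros g)
  ultimately show ?thesis
    using that[of \<phi>'] by (simp add: fact \<phi>'_def mult_ac)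
qed

text \<open>Each Blaschke factor has modulus at most \<open>\<kappa> < 1\<close> at \<open>\<beta>\<close>, while every quotient stays bounded by
  \<open>1\<close>; this bounds the number of factors. The conclusion expresses that \<open>\<phi>\<close> is a finite Blaschke
  product with denominator \<open>B\<close>: on the circle such a product is \<open>c z\<^sup>d cnj B / B\<close>.\<close>

lemma finite_blaschke_induct:
  assumes \<kappa>: "0 < \<kappa>" "\<kappa> < 1" and \<beta>: "\<beta> \<in> \<bbbD>" and "r < 1"
    and factor: "\<And>\<alpha>. cmod \<alpha> \<le> r \<Longrightarrow> cmod (\<beta> - \<alpha>) \<le> \<kappa> * cmod (1 - cnj \<alpha> * \<beta>)"
    and hol: "\<phi> holomorphic_on \<bbbD>" and lim: "((\<lambda>z. cmod (\<phi> z)) \<longlongrightarrow> 1) at_circle"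
    and zeros: "\<And>z. z \<in> \<bbbD> \<Longrightarrow> \<phi> z = 0 \<Longrightarrow> cmod z \<le> r"
    and big: "cmod (\<phi> \<beta>) \<ge> \<kappa> ^ N"
  shows "\<exists>B c d. (\<forall>z\<in>cball 0 1. poly B z \<noteq> 0) \<and>
    ((\<lambda>z. \<phi> z * poly B z - c * z ^ d * cnj (poly B z)) \<longlongrightarrow> 0) at_circle"
  using hol lim zeros big
proof (induction N arbitrary: \<phi>)
  case (0 \<phi>)
  have noz: "\<phi> \<alpha> \<noteq> 0" if \<alpha>: "\<alpha> \<in> \<bbbD>" for \<alpha>
  proof
    assume "\<phi> \<alpha> = 0"
    then obtain \<phi>' where \<phi>': "\<phi>' holomorphic_on \<bbbD>" "((\<lambda>z. cmod (\<phi>' z)) \<longlongrightarrow> 1) at_circle"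
      "\<And>z. z \<in> \<bbbD> \<Longrightarrow> \<phi> z * (1 - cnj \<alpha> * z) = (z - \<alpha>) * \<phi>' z"
      using divide_blaschke_factor[OF 0(1,2) \<alpha>] by metis
    have "cmod (1 - cnj \<alpha> * \<beta>) \<le> cmod (\<phi> \<beta> * (1 - cnj \<alpha> * \<beta>))"
      using 0(4) by (simp add: norm_mult mult_le_cancel_right1)
    also have "\<dots> \<le> cmod (\<beta> - \<alpha>)"
      using cmod_le_one_of_circle[OF \<phi>'(1,2) \<beta>] by (simp add: \<phi>'(3)[OF \<beta>] norm_mult mult_left_le)
    finally show False using blaschke_lt_one[of \<alpha> \<beta>] \<alpha> \<beta> by simp
  qed
  obtain c where c: "cmod c = 1" "\<And>z. z \<in> \<bbbD> \<Longrightarrow> \<phi> z = c"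
    using constant_of_circle_no_zero[OF 0(1,2) noz] by metis
  have "((\<lambda>z. \<phi> z * poly 1 z - c * z ^ 0 * cnj (poly 1 z)) \<longlongrightarrow> 0) at_circle"
    by (rule tendsto_eventually) (use at_circle_in_disc in eventually_elim, simp add: c)
  then show ?case by (intro exI[of _ 1] exI[of _ c] exI[of _ 0]) auto
next
  case (Suc N \<phi>)
  show ?case
  proof (cases "\<exists>\<alpha>\<in>\<bbbD>. \<phi> \<alpha> = 0")
    case False
    then obtain c where c: "cmod c = 1" "\<And>z. z \<in> \<bbbD> \<Longrightarrow> \<phi> z = c"
      using constant_of_circle_no_zero[OF Suc.prems(1,2)] by metis
    have "((\<lambda>z. \<phi> z * poly 1 z - c * z ^ 0 * cnj (poly 1 z)) \<longlongrightarrow> 0) at_circle"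
      by (rule tendsto_eventually) (use at_circle_in_disc in eventually_elim, simp add: c)
    then show ?thesis by (intro exI[of _ 1] exI[of _ c] exI[of _ 0]) auto
  next
    case True
    then obtain \<alpha> where \<alpha>: "\<alpha> \<in> \<bbbD>" "\<phi> \<alpha> = 0" by blast
    then obtain \<phi>' where \<phi>': "\<phi>' holomorphic_on \<bbbD>" "((\<lambda>z. cmod (\<phi>' z)) \<longlongrightarrow> 1) at_circle"
      and eq: "\<And>z. z \<in> \<bbbD> \<Longrightarrow> \<phi> z * (1 - cnj \<alpha> * z) = (z - \<alpha>) * \<phi>' z"
      using divide_blaschke_factor[OF Suc.prems(1,2)] by metis
    have denom: "1 - cnj \<alpha> * z \<noteq> 0" if "cmod z \<le> 1" for z
      using blaschke_denom[of \<alpha> z] \<alpha>(1) that by simp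
    have zeros': "cmod z \<le> r" if "z \<in> \<bbbD>" "\<phi>' z = 0" for z
      using eq[OF that(1)] denom[of z] Suc.prems(3)[OF that(1)] that by simp
    have "\<kappa> ^ Suc N * cmod (1 - cnj \<alpha> * \<beta>) \<le> cmod (\<phi> \<beta> * (1 - cnj \<alpha> * \<beta>))"
      using Suc.prems(4) by (simp add: norm_mult mult_right_mono)
    also have "\<dots> = cmod (\<beta> - \<alpha>) * cmod (\<phi>' \<beta>)"
      by (simp add: eq[OF \<beta>] norm_mult)
    also have "\<dots> \<le> \<kappa> * cmod (1 - cnj \<alpha> * \<beta>) * cmod (\<phi>' \<beta>)"
      using factor[OF Suc.prems(3)[OF \<alpha>]] by (intro mult_right_mono) auto
    finally have "\<kappa> ^ N * (\<kappa> * cmod (1 - cnj \<alpha> * \<beta>)) \<le> cmod (\<phi>' \<beta>) * (\<kappa> * cmod (1 - cnj \<alpha> * \<beta>))"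
      by (simp add: mult_ac)
    then have big': "\<kappa> ^ N \<le> cmod (\<phi>' \<beta>)"
      by (rule mult_right_le_imp_le) (use \<kappa>(1) denom[of \<beta>] \<beta> in simp)
    obtain B c d where B: "\<And>z. z \<in> cball 0 1 \<Longrightarrow> poly B z \<noteq> 0"
      and IH: "((\<lambda>z. \<phi>' z * poly B z - c * z ^ d * cnj (poly B z)) \<longlongrightarrow> 0) at_circle"
      using Suc.IH[OF \<phi>' zeros' big'] by blast
    define B' where "B' = B * [:1, - cnj \<alpha>:]"
    obtain M where M: "\<And>z. z \<in> \<bbbD> \<Longrightarrow> cmod (poly B z) \<le> M" using bounded_poly_disc by blast
    have "((\<lambda>z. (z - \<alpha>) * (\<phi>' z * poly B z - c * z ^ d * cnj (poly B z)) +
        c * z ^ d * cnj (poly B z) * \<alpha> * complex_of_real ((cmod z)\<^sup>2 - 1)) \<longlongrightarrow> 0 + 0) at_circle"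
    proof (intro tendsto_add bounded_mult_null_at_circle IH)
      show "cmod (z - \<alpha>) \<le> 2" if "z \<in> \<bbbD>" for z
        using norm_triangle_ineq4[of z \<alpha>] that \<alpha>(1) by simp
      show "((\<lambda>z. complex_of_real ((cmod z)\<^sup>2 - 1)) \<longlongrightarrow> 0) at_circle"
        using tendsto_of_real[OF tendsto_diff[OF tendsto_power[OF cmod_tendsto_at_circle, of 2] tendsto_const, of 1]]
        by simp
      show "cmod (c * z ^ d * cnj (poly B z) * \<alpha>) \<le> cmod c * 1 * M * 1" if "z \<in> \<bbbD>" for z
        unfolding norm_mult norm_power complex_mod_cnj
        using that \<alpha>(1) M[OF that] order_trans[OF norm_ge_zero M[OF that]]
        by (intro mult_mono mult_nonneg_nonneg) (auto simp: power_le_one)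
    qed
    moreover have "eventually (\<lambda>z. (z - \<alpha>) * (\<phi>' z * poly B z - c * z ^ d * cnj (poly B z)) +
        c * z ^ d * cnj (poly B z) * \<alpha> * complex_of_real ((cmod z)\<^sup>2 - 1) =
        \<phi> z * poly B' z - c * z ^ Suc d * cnj (poly B' z)) at_circle"
      using at_circle_in_disc
    proof eventually_elim
      case (elim z)
      have "\<phi> z * poly B' z = (\<phi> z * (1 - cnj \<alpha> * z)) * poly B z"
        by (simp add: B'_def algebra_simps)
      also have "\<dots> = (z - \<alpha>) * \<phi>' z * poly B z" by (simp only: eq[OF elim])
      finally have 1: "\<phi> z * poly B' z = (z - \<alpha>) * \<phi>' z * poly B z" .
      have 2: "cnj (poly B' z) = cnj (poly B z) * (1 - \<alpha> * cnj z)"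
        by (simp add: B'_def algebra_simps)
      show ?case
        unfolding 1 2 of_real_diff complex_norm_square by (simp add: algebra_simps)
    qed
    ultimately have "((\<lambda>z. \<phi> z * poly B' z - c * z ^ Suc d * cnj (poly B' z)) \<longlongrightarrow> 0 + 0) at_circle"
      by (rule Lim_transform_eventually)
    moreover have "poly B' z \<noteq> 0" if "z \<in> cball 0 1" for z
      using B[OF that] denom[of z] that by (simp add: B'_def mult.commute)
    ultimately show ?thesis by (intro exI[of _ B'] exI[of _ c] exI[of _ "Suc d"]) auto
  qed
qed

lemma finite_blaschke:
  assumes hol: "\<phi> holomorphic_on \<bbbD>" and lim: "((\<lambda>z. cmod (\<phi> z)) \<longlongrightarrow> 1) at_circle"
  obtains B c d where "\<And>z. z \<in> cball 0 1 \<Longrightarrow> poly B z \<noteq> 0"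
    "((\<lambda>z. \<phi> z * poly B z - c * z ^ d * cnj (poly B z)) \<longlongrightarrow> 0) at_circle"
proof -
  have "eventually (\<lambda>z. cmod (\<phi> z) > 0) at_circle"
    by (rule order_tendstoD(1)[OF lim]) simp
  then obtain r where r: "0 < r" "r < 1" "\<And>z. r < cmod z \<Longrightarrow> cmod z < 1 \<Longrightarrow> \<phi> z \<noteq> 0"
    by (auto simp: eventually_at_circle)
  \<comment> \<open>A point farther out than all zeros, so that Blaschke factors cannot vanish there.\<close>
  define \<beta> where "\<beta> = complex_of_real ((1 + r) / 2)"
  have nb: "cmod \<beta> = (1 + r) / 2" using r unfolding \<beta>_def norm_of_real by simp
  have \<beta>: "\<beta> \<in> \<bbbD>" and \<beta>r: "cmod \<beta> > r" and \<phi>\<beta>: "\<phi> \<beta> \<noteq> 0" using r nb by auto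
  let ?b = "\<lambda>\<alpha>. cmod (\<beta> - \<alpha>) / cmod (1 - cnj \<alpha> * \<beta>)"
  have denom: "1 - cnj \<alpha> * \<beta> \<noteq> 0" if "\<alpha> \<in> cball 0 r" for \<alpha>
    using blaschke_denom[of \<alpha> \<beta>] that r(2) \<beta> by simp
  have "continuous_on (cball 0 r) ?b"
    using denom by (intro continuous_intros) auto
  then obtain \<alpha> where \<alpha>: "\<alpha> \<in> cball 0 r" "\<And>y. y \<in> cball 0 r \<Longrightarrow> ?b y \<le> ?b \<alpha>"
    using continuous_attains_sup[of "cball 0 r" ?b] r(1) by auto
  define \<kappa> where "\<kappa> = ?b \<alpha>"
  have "?b \<alpha> < 1"
    using blaschke_lt_one[of \<alpha> \<beta>] \<alpha>(1) r(2) \<beta> denom[OF \<alpha>(1)] by simp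
  moreover have "\<beta> \<noteq> \<alpha>" using \<alpha>(1) \<beta>r by auto
  then have "?b \<alpha> > 0" using denom[OF \<alpha>(1)] by simp
  ultimately have \<kappa>: "0 < \<kappa>" "\<kappa> < 1" by (auto simp: \<kappa>_def)
  have factor: "cmod (\<beta> - y) \<le> \<kappa> * cmod (1 - cnj y * \<beta>)" if "cmod y \<le> r" for y
    using \<alpha>(2)[of y] denom[of y] that by (simp add: \<kappa>_def pos_divide_le_eq)
  obtain N where "\<kappa> ^ N < cmod (\<phi> \<beta>)"
    using real_arch_pow_inv[of "cmod (\<phi> \<beta>)" \<kappa>] \<kappa> \<phi>\<beta> by auto
  moreover have "cmod z \<le> r" if "z \<in> \<bbbD>" "\<phi> z = 0" for z
    using r(3)[of z] that by force
  ultimately show ?thesis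
    using finite_blaschke_induct[OF \<kappa> \<beta> r(2) factor hol lim, of N] that by (meson less_imp_le)
qed

lemma has_integral_circle:
  assumes "(f has_contour_integral I) (circlepath 0 r)"
  shows "((\<lambda>t. f (r * exp (2 * of_real pi * \<i> * of_real t)) *
    (2 * pi * \<i> * r * exp (2 * of_real pi * \<i> * of_real t))) has_integral I) {0..1}"
  using assms unfolding has_contour_integral_def
proof (rule has_integral_eq[rotated])
  fix t :: real assume "t \<in> {0..1}"
  then have "vector_derivative (circlepath 0 r) (at t within {0..1}) =
      2 * pi * \<i> * r * exp (2 * of_real pi * \<i> * of_real t)"
    by (intro vector_derivative_circlepath01) auto
  then show "f (circlepath 0 r t) * vector_derivative (circlepath 0 r) (at t within {0..1}) =
      f (r * exp (2 * of_real pi * \<i> * of_real t)) * (2 * pi * \<i> * r * exp (2 * of_real pi * \<i> * of_real t))"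
    by (simp add: circlepath)
qed

lemma average_circle_power:
  fixes r :: real and f :: "complex \<Rightarrow> complex"
  assumes "f holomorphic_on \<bbbD>" "0 < r" "r < 1" "0 < n"
  shows "((\<lambda>t. f (r * exp (2 * of_real pi * \<i> * of_real t)) * exp (2 * of_real pi * \<i> * of_real t) ^ n)
    has_integral 0) {0..1}"
proof -
  let ?e = "\<lambda>t. exp (2 * of_real pi * \<i> * of_real t)"
  obtain k where n: "n = Suc k" using \<open>0 < n\<close> gr0_implies_Suc by blast
  have "((\<lambda>z. f z * z ^ k) has_contour_integral 0) (circlepath 0 r)"
    using assms by (intro Cauchy_theorem_disc_simple[where a = 0 and e = 1] holomorphic_intros) auto
  then have "((\<lambda>t. f (r * ?e t) * (r * ?e t) ^ k * (2 * pi * \<i> * r * ?e t)) has_integral 0) {0..1}"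
    by (rule has_integral_circle)
  from has_integral_mult_right[OF this, of "1 / (2 * pi * \<i> * r ^ n)"]
  show ?thesis
    unfolding mult_zero_right
    by (rule has_integral_eq[rotated])
       (use assms in \<open>auto simp: n power_mult_distrib field_simps\<close>)
qed

lemma average_circle_coeff:
  fixes r :: real and f :: "complex \<Rightarrow> complex"
  assumes "f holomorphic_on \<bbbD>" "0 < r" "r < 1"
  shows "((\<lambda>t. f (r * exp (2 * of_real pi * \<i> * of_real t)) * cnj (exp (2 * of_real pi * \<i> * of_real t)) ^ k)
    has_integral (deriv ^^ k) f 0 / fact k * r ^ k) {0..1}"
proof -
  let ?e = "\<lambda>t. exp (2 * of_real pi * \<i> * of_real t)"
  have sub: "cball 0 r \<subseteq> \<bbbD>" using assms by auto
  have "((\<lambda>z. f z / (z - 0) ^ Suc k) has_contour_integral (2 * pi * \<i> / fact k * (deriv ^^ k) f 0)) (circlepath 0 r)"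
    using assms sub
    by (intro Cauchy_has_contour_integral_higher_derivative_circlepath holomorphic_on_imp_continuous_on
        holomorphic_on_subset[OF assms(1)]) auto
  then have "((\<lambda>t. f (r * ?e t) / (r * ?e t) ^ Suc k * (2 * pi * \<i> * r * ?e t)) has_integral
      (2 * pi * \<i> / fact k * (deriv ^^ k) f 0)) {0..1}"
    unfolding diff_0_right by (rule has_integral_circle)
  from has_integral_mult_right[OF this, of "r ^ k / (2 * pi * \<i>)"]
  have "((\<lambda>t. f (r * ?e t) * cnj (?e t) ^ k) has_integral
      (r ^ k / (2 * pi * \<i>) * (2 * pi * \<i> / fact k * (deriv ^^ k) f 0))) {0..1}"
  proof (rule has_integral_eq[rotated])
    fix t :: real
    have cnj_e: "cnj (?e t) = inverse (?e t)"
      by (simp add: exp_cnj exp_minus[symmetric])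
    show "r ^ k / (2 * pi * \<i>) * (f (r * ?e t) / (r * ?e t) ^ Suc k * (2 * pi * \<i> * r * ?e t)) =
        f (r * ?e t) * cnj (?e t) ^ k"
      unfolding cnj_e using assms by (simp add: power_mult_distrib field_simps)
  qed
  then show ?thesis by (simp add: mult_ac)
qed

text \<open>On \<open>\<bar>z\<bar> = 1\<close> the function \<open>c z\<^sup>d cnj (G z)\<close> has no Fourier coefficients of index above \<open>d\<close>, so
  neither has \<open>G\<close>. The coefficients are computed on smaller circles.\<close>

lemma polynomial_of_symmetry:
  assumes hol: "G holomorphic_on \<bbbD>"
    and lim: "((\<lambda>z. G z - c * z ^ d * cnj (G z)) \<longlongrightarrow> 0) at_circle"
  obtains p where "\<And>z. z \<in> \<bbbD> \<Longrightarrow> G z = poly p z"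
proof -
  define a where "a k = (deriv ^^ k) G 0 / fact k" for k
  have a0: "a k = 0" if "k > d" for k
  proof -
    have bound: "cmod (a k) * (1/2) ^ k \<le> 0 + e" if "e > 0" for e
    proof -
      have "eventually (\<lambda>z. cmod (G z - c * z ^ d * cnj (G z)) < e) at_circle"
        using tendstoD[OF lim \<open>e > 0\<close>] by (simp add: dist_norm)
      then obtain r where r: "0 < r" "r < 1"
        and small: "\<And>z. r < cmod z \<Longrightarrow> cmod z < 1 \<Longrightarrow> cmod (G z - c * z ^ d * cnj (G z)) < e"
        by (auto simp: eventually_at_circle)
      \<comment> \<open>The bound \<open>s > 1/2\<close> keeps \<open>s\<^sup>k\<close> away from \<open>0\<close> while \<open>e\<close> decreases.\<close>
      obtain s where s: "max r (1/2) < s" "s < 1"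
        using dense[of "max r (1/2)" 1] r(2) by auto
      have "0 < s" using s r by linarith
      let ?e = "\<lambda>t. exp (2 * of_real pi * \<i> * of_real t)"
      have ee: "?e t * cnj (?e t) = 1" for t :: real
        by (simp add: exp_cnj exp_minus[symmetric] mult_exp_exp)
      have "((\<lambda>t. G (s * ?e t) * ?e t ^ (k - d)) has_integral 0) {0..1}"
        using \<open>k > d\<close> \<open>0 < s\<close> s(2) by (intro average_circle_power hol) auto
      then have "(cnj \<circ> (\<lambda>t. G (s * ?e t) * ?e t ^ (k - d)) has_integral cnj 0) {0..1}"
        by (simp only: has_integral_cnj)
      then have "((\<lambda>t. cnj (G (s * ?e t) * ?e t ^ (k - d))) has_integral 0) {0..1}"
        by (simp only: comp_def complex_cnj_zero)
      from has_integral_mult_right[OF this, of "c * s ^ d"]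
      have refl: "((\<lambda>t. c * s ^ d * cnj (G (s * ?e t) * ?e t ^ (k - d))) has_integral 0) {0..1}"
        by simp
      have "((\<lambda>t. G (s * ?e t) * cnj (?e t) ^ k - c * s ^ d * cnj (G (s * ?e t) * ?e t ^ (k - d)))
          has_integral a k * s ^ k - 0) {0..1}"
        unfolding a_def using \<open>0 < s\<close> s(2) by (intro has_integral_diff average_circle_coeff hol refl) auto
      then have "((\<lambda>t. (G (s * ?e t) - c * (s * ?e t) ^ d * cnj (G (s * ?e t))) * cnj (?e t) ^ k)
          has_integral a k * s ^ k) {0..1}"
        unfolding diff_0_right
      proof (rule has_integral_eq[rotated])
        fix t :: real
        have "cnj (?e t) ^ k = cnj (?e t) ^ d * cnj (?e t) ^ (k - d)"
          using \<open>k > d\<close> by (simp add: power_add[symmetric])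
        then have "?e t ^ d * cnj (?e t) ^ k = (?e t * cnj (?e t)) ^ d * cnj (?e t) ^ (k - d)"
          by (simp add: power_mult_distrib)
        then have shift: "cnj (?e t) ^ (k - d) = ?e t ^ d * cnj (?e t) ^ k"
          by (simp only: ee power_one mult_1)
        have alg: "g * x - c * S * (h * (E * x)) = (g - c * (S * E) * h) * x" for g x S h E :: complex
          by (simp add: algebra_simps)
        show "G (s * ?e t) * cnj (?e t) ^ k - c * s ^ d * cnj (G (s * ?e t) * ?e t ^ (k - d)) =
            (G (s * ?e t) - c * (s * ?e t) ^ d * cnj (G (s * ?e t))) * cnj (?e t) ^ k"
          by (simp only: power_mult_distrib complex_cnj_mult complex_cnj_power of_real_power shift alg)
      qed
      then have "cmod (a k * s ^ k) \<le> e * measure lborel {0..1::real}"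
      proof (rule has_integral_bound_real[where S = "{}", rotated 2])
        fix t :: real
        have n: "cmod (?e t) = 1" by simp
        have m: "cmod (s * ?e t) = s" using \<open>0 < s\<close> by (simp only: norm_mult n) simp
        then show "cmod ((G (s * ?e t) - c * (s * ?e t) ^ d * cnj (G (s * ?e t))) * cnj (?e t) ^ k) \<le> e"
          using small[of "s * ?e t", unfolded m] s
          unfolding norm_mult[of _ "cnj (?e t) ^ k"] norm_power[of "cnj (?e t)"] complex_mod_cnj n power_one mult_1_right
          by auto
      qed (use \<open>e > 0\<close> in auto)
      then have "cmod (a k) * s ^ k \<le> e" using \<open>0 < s\<close> by (simp add: norm_mult norm_power)
      moreover have "(1/2) ^ k \<le> s ^ k" using s by (intro power_mono) auto
      then have "cmod (a k) * (1/2) ^ k \<le> cmod (a k) * s ^ k" by (intro mult_left_mono) auto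
      ultimately show ?thesis by simp
    qed
    have "cmod (a k) * (1/2) ^ k \<le> 0" by (rule field_le_epsilon) (rule bound)
    then have "cmod (a k) * (1/2) ^ k \<le> 0 * (1/2) ^ k" by simp
    then have "cmod (a k) \<le> 0" by (rule mult_right_le_imp_le) simp
    then show ?thesis by simp
  qed
  have "G z = poly (\<Sum>k\<le>d. monom (a k) k) z" if "z \<in> \<bbbD>" for z
  proof -
    have "(\<lambda>k. a k * z ^ k) sums G z"
      using holomorphic_power_series[OF hol that] by (simp add: a_def)
    moreover have "(\<lambda>k. a k * z ^ k) sums (\<Sum>k\<le>d. a k * z ^ k)"
      by (rule sums_finite) (auto simp: a0)
    ultimately show ?thesis by (simp add: sums_unique2 poly_sum poly_monom)
  qed
  with that show ?thesis by blast
qed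

section \<open>Families of polynomials whose roots tend to the circle\<close>

text \<open>If all \<open>\<bar>a\<bar> = 1\<close>, then \<open>1 - cnj a * w = - cnj a * (w - a)\<close>, so a monic polynomial with unimodular
  roots is its own reversed conjugate up to the factor \<open>cnj (p 0)\<close>. This is the quantitative version
  for \<open>\<bar>w\<bar> = 1\<close>; the bound on the product itself controls the error when a factor is added.\<close>

lemma self_reciprocal_estimate:
  fixes A :: "complex multiset"
  assumes "\<And>a. a \<in># A \<Longrightarrow> cmod a \<le> 1" "\<And>a. a \<in># A \<Longrightarrow> 1 - (cmod a)\<^sup>2 \<le> e" "0 \<le> e" "cmod w = 1"
  shows "cmod (cnj (\<Prod>a\<in>#A. - a) * (\<Prod>a\<in>#A. w - a) - w ^ size A * cnj (\<Prod>a\<in>#A. w - a))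
      \<le> real (size A) * 2 ^ size A * e \<and> cmod (\<Prod>a\<in>#A. w - a) \<le> 2 ^ size A"
  using assms(1,2)
proof (induction A)
  case empty
  then show ?case by simp
next
  case (add a A)
  let ?N = "cnj (\<Prod>a\<in>#A. - a)" and ?P = "\<Prod>a\<in>#A. w - a" and ?n = "size A"
  have IH: "cmod (?N * ?P - w ^ ?n * cnj ?P) \<le> real ?n * 2 ^ ?n * e" "cmod ?P \<le> 2 ^ ?n"
    using add by auto
  have a: "cmod a \<le> 1" "1 - (cmod a)\<^sup>2 \<le> e" using add.prems by auto
  have ww: "w * cnj w = 1" using \<open>cmod w = 1\<close> by (simp add: complex_norm_square[symmetric])
  have wa: "cmod (w - a) \<le> 2" using norm_triangle_ineq4[of w a] a \<open>cmod w = 1\<close> by simp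
  have x: "cmod (cnj (- a) * (w - a)) \<le> 1 * 2"
    unfolding norm_mult using a(1) wa by (intro mult_mono) auto
  have xy: "cnj (- a) * (w - a) - w * cnj (w - a) = - complex_of_real (1 - (cmod a)\<^sup>2)"
    unfolding of_real_diff complex_norm_square using ww by (simp add: algebra_simps)
  have xy': "cmod (cnj (- a) * (w - a) - w * cnj (w - a)) \<le> e"
    unfolding xy norm_minus_cancel norm_of_real using a by (simp add: power_le_one)
  have "cnj (- a) * (w - a) * (?N * ?P) - w * cnj (w - a) * (w ^ ?n * cnj ?P) =
      cnj (- a) * (w - a) * (?N * ?P - w ^ ?n * cnj ?P) +
      (cnj (- a) * (w - a) - w * cnj (w - a)) * (w ^ ?n * cnj ?P)"
    by (simp add: algebra_simps)
  also have "cmod \<dots> \<le> (1 * 2) * (real ?n * 2 ^ ?n * e) + e * (1 * 2 ^ ?n)"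
  proof (intro norm_triangle_mono)
    show "cmod (cnj (- a) * (w - a) * (?N * ?P - w ^ ?n * cnj ?P)) \<le> (1 * 2) * (real ?n * 2 ^ ?n * e)"
      unfolding norm_mult[of "cnj (- a) * (w - a)"] using x IH(1) by (intro mult_mono) auto
    show "cmod ((cnj (- a) * (w - a) - w * cnj (w - a)) * (w ^ ?n * cnj ?P)) \<le> e * (1 * 2 ^ ?n)"
      unfolding norm_mult[of "cnj (- a) * (w - a) - w * cnj (w - a)"]
      using xy' IH(2) \<open>0 \<le> e\<close>
      by (intro mult_mono) (auto simp: norm_mult norm_power \<open>cmod w = 1\<close>)
  qed
  also have "\<dots> \<le> real (size (add_mset a A)) * 2 ^ size (add_mset a A) * e"
    using \<open>0 \<le> e\<close> by (simp add: algebra_simps)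
  finally have "cmod (cnj (- a) * (w - a) * (?N * ?P) - w * cnj (w - a) * (w ^ ?n * cnj ?P))
    \<le> real (size (add_mset a A)) * 2 ^ size (add_mset a A) * e" .
  moreover have "cmod ((w - a) * ?P) \<le> 2 * 2 ^ ?n"
    unfolding norm_mult using wa IH(2) by (intro mult_mono) auto
  ultimately show ?case by (simp add: mult_ac)
qed

lemma monic_root_multiset:
  fixes p :: "complex poly"
  assumes "lead_coeff p = 1"
  obtains A where "size A = degree p" "\<And>w. poly p w = (\<Prod>a\<in>#A. w - a)"
    "\<And>w. poly p w = 0 \<longleftrightarrow> w \<in># A"
proof -
  have "p \<noteq> 0" using assms by auto
  then obtain A where A: "size A = degree p" "p = smult (lead_coeff p) (\<Prod>a\<in>#A. [:- a, 1:])"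
    using alg_closed_imp_factorization by blast
  have eval: "poly p w = (\<Prod>a\<in>#A. w - a)" for w
  proof -
    have "poly (\<Prod>a\<in>#A. [:- a, 1:]) w = (\<Prod>a\<in>#A. w - a)"
      by (induction A) (auto simp: algebra_simps)
    then show ?thesis using A(2) assms by simp
  qed
  show ?thesis
    by (rule that[OF A(1) eval]) (auto simp: eval prod_mset_zero_iff)
qed

text \<open>With the roots tending to the circle, this makes the modulus of the constant coefficient tend to
  \<open>1\<close>.\<close>

lemma cmod_prod_mset_bounds:
  assumes "\<And>a. a \<in># A \<Longrightarrow> cmod a \<le> 1" "\<And>a. a \<in># A \<Longrightarrow> 1 - cmod a \<le> e"
  shows "cmod (\<Prod>a\<in>#A. - a) \<le> 1 \<and> 1 - real (size A) * e \<le> cmod (\<Prod>a\<in>#A. - a)"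
  using assms
proof (induction A)
  case (add a A)
  let ?p = "cmod (\<Prod>a\<in>#A. - a)"
  have IH: "?p \<le> 1" "1 - real (size A) * e \<le> ?p" using add by auto
  have a: "cmod a \<le> 1" "1 - cmod a \<le> e" using add.prems by auto
  have "(1 - cmod a) * ?p \<le> (1 - cmod a) * 1" using IH(1) a by (intro mult_left_mono) auto
  then have "?p - e \<le> cmod a * ?p" using a by (simp add: algebra_simps)
  moreover have "cmod a * ?p \<le> 1" using a IH(1) by (simp add: mult_le_one)
  ultimately show ?case using IH(2) by (simp add: norm_mult algebra_simps)
qed simp

lemma cmod_prod_mset_ge_power:
  assumes "\<And>a. a \<in># A \<Longrightarrow> \<delta> \<le> cmod (w - a)" "0 \<le> \<delta>"
  shows "\<delta> ^ size A \<le> cmod (\<Prod>a\<in>#A. w - a)"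
  using assms(1)
proof (induction A)
  case (add a A)
  then have "\<delta> * \<delta> ^ size A \<le> cmod (w - a) * cmod (\<Prod>a\<in>#A. w - a)"
    using assms(2) by (intro mult_mono) auto
  then show ?case by (simp add: norm_mult)
qed simp

text \<open>The basis polynomials depend on the nodes alone, so a polynomial with parameters is a combination
  of fixed polynomials with its values at the nodes as coefficients.\<close>

lemma lagrange_interpolation:
  fixes S :: "'a::field set"
  assumes "finite S"
  obtains l where "\<And>p. degree p < card S \<Longrightarrow> p = (\<Sum>s\<in>S. smult (poly p s) (l s))"
proof -
  define l where "l s = smult (1 / (\<Prod>t\<in>S - {s}. s - t)) (\<Prod>t\<in>S - {s}. [:- t, 1:])" for s
  have eval: "poly (l s) x = (if x = s then 1 else 0)" if "x \<in> S" "s \<in> S" for x s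
  proof (cases "x = s")
    case True
    have "(\<Prod>t\<in>S - {s}. s - t) \<noteq> 0" using assms by (auto simp: prod_zero_iff)
    then show ?thesis by (simp add: l_def poly_prod True)
  next
    case False
    then have "(\<Prod>t\<in>S - {s}. x - t) = 0" using assms that by (auto simp: prod_zero_iff)
    then show ?thesis using False by (simp add: l_def poly_prod)
  qed
  have deg: "degree (l s) < card S" if "s \<in> S" for s
  proof -
    have "degree (\<Prod>t\<in>S - {s}. [:- t, 1:]) = card (S - {s})"
      by (subst degree_prod_eq_sum_degree) auto
    also have "\<dots> < card S" using assms that by (rule card_Diff1_less)
    finally show ?thesis unfolding l_def using degree_smult_le le_less_trans by blast
  qed
  have "p = (\<Sum>s\<in>S. smult (poly p s) (l s))" if "degree p < card S" for p
  proof (rule poly_eqI_degree[where A = S])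
    fix x assume x: "x \<in> S"
    have "poly (\<Sum>s\<in>S. smult (poly p s) (l s)) x = (\<Sum>s\<in>S. if s = x then poly p s else 0)"
      unfolding poly_sum using eval[OF x] by (intro sum.cong) auto
    also have "\<dots> = poly p x" using assms x by (subst sum.delta) auto
    finally show "poly p x = poly (\<Sum>s\<in>S. smult (poly p s) (l s)) x" ..
  next
    show "degree (\<Sum>s\<in>S. smult (poly p s) (l s)) < card S"
    proof (rule degree_sum_less)
      show "0 < card S" using that by simp
      show "degree (smult (poly p s) (l s)) < card S" if "s \<in> S" for s
        using deg[OF that] degree_smult_le le_less_trans by blast
    qed
  qed fact
  with that show ?thesis by blast
qed

definition monic_family :: "nat \<Rightarrow> (complex \<Rightarrow> complex poly) \<Rightarrow> bool" where
  "monic_family m P \<longleftrightarrow> (\<forall>z\<in>\<bbbD>. degree (P z) = m \<and> coeff (P z) m = 1) \<and>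
    (\<forall>k. (\<lambda>z. coeff (P z) k) holomorphic_on \<bbbD>)"

lemma monic_family_poly_eq:
  assumes "monic_family m P" "z \<in> \<bbbD>"
  shows "poly (P z) w = (\<Sum>k\<le>m. coeff (P z) k * w ^ k)"
  using assms by (simp add: poly_altdef monic_family_def)

lemma monic_family_holomorphic:
  assumes "monic_family m P"
  shows "(\<lambda>z. poly (P z) w) holomorphic_on \<bbbD>"
proof (rule holomorphic_transform)
  show "(\<lambda>z. \<Sum>k\<le>m. coeff (P z) k * w ^ k) holomorphic_on \<bbbD>"
    using assms by (intro holomorphic_intros) (auto simp: monic_family_def)
qed (simp add: monic_family_poly_eq[OF assms])

text \<open>For \<open>\<bar>w\<bar> = 1\<close> the function \<open>F = P(\<cdot>, w)\<close> satisfies \<open>F = w\<^sup>m \<phi> cnj F\<close> on the circle, where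
  \<open>\<phi> = P(\<cdot>, 0)\<close> is a finite Blaschke product. Multiplied by the denominator \<open>B\<close> of \<open>\<phi>\<close>, it is
  therefore a polynomial. Interpolation at \<open>m + 1\<close> unimodular points \<open>w\<close> reaches every \<open>w\<close>.\<close>

lemma monic_family_algebraic:
  assumes P: "monic_family m P"
    and roots: "\<And>z w. z \<in> \<bbbD> \<Longrightarrow> poly (P z) w = 0 \<Longrightarrow> cmod w \<le> 1"
    and circle: "\<And>e. e > 0 \<Longrightarrow> eventually (\<lambda>z. \<forall>w. poly (P z) w = 0 \<longrightarrow> 1 - cmod w \<le> e) at_circle"
  obtains Q B where "\<And>z. z \<in> cball 0 1 \<Longrightarrow> poly B z \<noteq> 0"
    "\<And>z w. z \<in> \<bbbD> \<Longrightarrow> poly2 Q (z, w) = poly B z * poly (P z) w"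
proof -
  have "lead_coeff (P z) = 1" if "z \<in> \<bbbD>" for z
    using P that by (simp add: monic_family_def)
  then have "\<exists>A. size A = m \<and> (\<forall>w. poly (P z) w = (\<Prod>a\<in>#A. w - a)) \<and> (\<forall>w. poly (P z) w = 0 \<longleftrightarrow> w \<in># A)"
    if "z \<in> \<bbbD>" for z
    using monic_root_multiset[of "P z"] P that unfolding monic_family_def by metis
  then obtain A where A: "\<And>z. z \<in> \<bbbD> \<Longrightarrow> size (A z) = m"
    "\<And>z w. z \<in> \<bbbD> \<Longrightarrow> poly (P z) w = (\<Prod>a\<in>#A z. w - a)"
    "\<And>z w. z \<in> \<bbbD> \<Longrightarrow> poly (P z) w = 0 \<longleftrightarrow> w \<in># A z"
    by metis
  have A1: "cmod a \<le> 1" if "z \<in> \<bbbD>" "a \<in># A z" for z a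
    using roots A(3) that by blast
  have hol: "(\<lambda>z. poly (P z) w) holomorphic_on \<bbbD>" for w
    by (rule monic_family_holomorphic[OF P])
  define \<phi> where "\<phi> z = poly (P z) 0" for z
  have \<phi>_eq: "\<phi> z = (\<Prod>a\<in>#A z. - a)" if "z \<in> \<bbbD>" for z
    by (simp add: \<phi>_def A(2)[OF that])
  have \<phi>_le: "cmod (\<phi> z) \<le> 1" if "z \<in> \<bbbD>" for z
    using cmod_prod_mset_bounds[of "A z" 1] A1[OF that] by (simp add: \<phi>_eq[OF that])
  have scale: "\<exists>e'>0. real m * e' \<le> e \<and> real m * 2 ^ m * (2 * e') < e" if "e > 0" for e :: real
  proof -
    \<comment> \<open>Small enough for the errors in both estimates on products over the \<open>m\<close> roots.\<close>
    define e' where "e' = e / (2 * (real m + 1) * 2 ^ m)"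
    have c: "2 * (real m + 1) * 2 ^ m > (0::real)" by (intro mult_pos_pos) auto
    have "e' > 0" using that c unfolding e'_def by (rule divide_pos_pos)
    have e: "e = e' * (2 * (real m + 1) * 2 ^ m)" using c by (simp add: e'_def)
    have small: "real m * 2 ^ m * (2 * e') < e"
      unfolding e using \<open>e' > 0\<close> by (simp add: algebra_simps)
    have "(1::real) \<le> 2 * 2 ^ m" using one_le_power[of "2::real" m] by linarith
    then have "real m * e' * 1 \<le> real m * e' * (2 * 2 ^ m)"
      using \<open>e' > 0\<close> by (intro mult_left_mono) auto
    also have "\<dots> = real m * 2 ^ m * (2 * e')" by (simp add: mult_ac)
    also note small
    finally show ?thesis using \<open>e' > 0\<close> small by (intro exI[of _ e']) auto
  qed
  have \<phi>_lim: "((\<lambda>z. cmod (\<phi> z)) \<longlongrightarrow> 1) at_circle"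
  proof (rule tendstoI)
    fix e :: real assume "e > 0"
    then obtain e' where e': "e' > 0" "real m * e' \<le> e / 2"
      using scale[of "e / 2"] by auto
    show "eventually (\<lambda>z. dist (cmod (\<phi> z)) 1 < e) at_circle"
      using circle[OF e'(1)] at_circle_in_disc
    proof eventually_elim
      case (elim z)
      then have "1 - real m * e' \<le> cmod (\<phi> z)"
        using cmod_prod_mset_bounds[of "A z" e'] A1[OF elim(2)]
        by (simp add: \<phi>_eq[OF elim(2)] A(1)[OF elim(2)] A(3)[OF elim(2)])
      then show ?case using \<phi>_le[OF elim(2)] e'(2) \<open>e > 0\<close> by (simp add: dist_real_def)
    qed
  qed
  obtain B c d where B: "\<And>z. z \<in> cball 0 1 \<Longrightarrow> poly B z \<noteq> 0"
    and B_lim: "((\<lambda>z. \<phi> z * poly B z - c * z ^ d * cnj (poly B z)) \<longlongrightarrow> 0) at_circle"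
    using finite_blaschke[of \<phi>] hol \<phi>_lim unfolding \<phi>_def by blast
  have "\<exists>p. \<forall>z\<in>\<bbbD>. poly B z * poly (P z) w = poly p z" if w: "cmod w = 1" for w
  proof -
    define F where "F z = poly (P z) w" for z
    have F_le: "cmod (F z) \<le> 2 ^ m" if "z \<in> \<bbbD>" for z
      using self_reciprocal_estimate[of "A z" 1 w] A1[OF that] w
      by (simp add: F_def A(1,2)[OF that])
    have "((\<lambda>z. cnj (\<phi> z) * F z - w ^ m * cnj (F z)) \<longlongrightarrow> 0) at_circle"
    proof (rule tendstoI)
      fix e :: real assume "e > 0"
      then obtain e' where e': "e' > 0" "real m * 2 ^ m * (2 * e') < e"
        using scale by blast
      show "eventually (\<lambda>z. dist (cnj (\<phi> z) * F z - w ^ m * cnj (F z)) 0 < e) at_circle"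
        using circle[OF e'(1)] at_circle_in_disc
      proof eventually_elim
        case (elim z)
        have "1 - (cmod a)\<^sup>2 \<le> 2 * e'" if "a \<in># A z" for a
        proof -
          have "1 - (cmod a)\<^sup>2 = (1 - cmod a) * (1 + cmod a)" by (simp add: power2_eq_square algebra_simps)
          also have "\<dots> \<le> e' * 2"
            using elim A(3)[OF elim(2)] A1[OF elim(2)] that e'(1) by (intro mult_mono) auto
          finally show ?thesis by simp
        qed
        then have "cmod (cnj (\<phi> z) * F z - w ^ m * cnj (F z)) \<le> real m * 2 ^ m * (2 * e')"
          using self_reciprocal_estimate[of "A z" "2 * e'" w] A1[OF elim(2)] w e'(1)
          by (simp add: F_def \<phi>_eq[OF elim(2)] A(1,2)[OF elim(2)])
        then show ?case using e'(2) by simp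
      qed
    qed
    then have "((\<lambda>z. \<phi> z * (cnj (\<phi> z) * F z - w ^ m * cnj (F z))) \<longlongrightarrow> 0) at_circle"
      by (rule bounded_mult_null_at_circle) (rule \<phi>_le)
    moreover have "((\<lambda>z. F z * complex_of_real (1 - (cmod (\<phi> z))\<^sup>2)) \<longlongrightarrow> 0) at_circle"
    proof (rule bounded_mult_null_at_circle[OF _ F_le])
      have "((\<lambda>z. complex_of_real (1 - (cmod (\<phi> z))\<^sup>2)) \<longlongrightarrow> complex_of_real (1 - 1\<^sup>2)) at_circle"
        by (intro tendsto_intros \<phi>_lim)
      then show "((\<lambda>z. complex_of_real (1 - (cmod (\<phi> z))\<^sup>2)) \<longlongrightarrow> 0) at_circle" by simp
    qed
    ultimately have "((\<lambda>z. \<phi> z * (cnj (\<phi> z) * F z - w ^ m * cnj (F z)) +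
        F z * complex_of_real (1 - (cmod (\<phi> z))\<^sup>2)) \<longlongrightarrow> 0) at_circle"
      by (rule tendsto_add_zero)
    then have F_lim: "((\<lambda>z. F z - \<phi> z * w ^ m * cnj (F z)) \<longlongrightarrow> 0) at_circle"
      unfolding of_real_diff complex_norm_square by (simp add: algebra_simps)
    obtain M where M: "\<And>z. z \<in> \<bbbD> \<Longrightarrow> cmod (poly B z) \<le> M" using bounded_poly_disc by blast
    have "((\<lambda>z. poly B z * (F z - \<phi> z * w ^ m * cnj (F z)) +
        w ^ m * cnj (F z) * (\<phi> z * poly B z - c * z ^ d * cnj (poly B z))) \<longlongrightarrow> 0) at_circle"
    proof (intro tendsto_add_zero bounded_mult_null_at_circle F_lim B_lim)
      show "cmod (w ^ m * cnj (F z)) \<le> 2 ^ m" if "z \<in> \<bbbD>" for z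
        using F_le[OF that] w by (simp add: norm_mult norm_power)
    qed (rule M)
    then have "((\<lambda>z. poly B z * F z - (c * w ^ m) * z ^ d * cnj (poly B z * F z)) \<longlongrightarrow> 0) at_circle"
      by (simp add: algebra_simps)
    moreover have "(\<lambda>z. poly B z * F z) holomorphic_on \<bbbD>"
      unfolding F_def by (intro holomorphic_intros hol)
    ultimately obtain p where "\<And>z. z \<in> \<bbbD> \<Longrightarrow> poly B z * F z = poly p z"
      using polynomial_of_symmetry[of "\<lambda>z. poly B z * F z"] by blast
    then show ?thesis unfolding F_def by blast
  qed
  then obtain p where p: "\<And>w z. cmod w = 1 \<Longrightarrow> z \<in> \<bbbD> \<Longrightarrow> poly B z * poly (P z) w = poly (p w) z"
    by metis
  \<comment> \<open>Roots of unity serve as \<open>m + 1\<close> distinct unimodular nodes.\<close>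
  define S where "S = {s::complex. s ^ Suc m = 1}"
  have "cmod s = 1" if "s \<in> S" for s
  proof -
    have "cmod s ^ Suc m = 1 ^ Suc m"
      using that unfolding S_def norm_power[symmetric] by simp
    then show ?thesis by (rule power_eq_imp_eq_base) auto
  qed
  then have S: "S \<subseteq> sphere 0 1" "finite S" "card S = Suc m"
    unfolding S_def using finite_roots_unity[of "Suc m"] card_roots_unity_eq[of "Suc m"] by auto
  obtain l where l: "\<And>p. degree p < card S \<Longrightarrow> p = (\<Sum>s\<in>S. smult (poly p s) (l s))"
    using lagrange_interpolation[OF S(2)] by blast
  define Q where "Q = (\<Sum>s\<in>S. smult (p s) (map_poly (\<lambda>c. [:c:]) (l s)))"
  have "poly2 Q (z, w) = poly B z * poly (P z) w" if z: "z \<in> \<bbbD>" for z w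
  proof -
    have e: "poly2 (smult r (map_poly (\<lambda>c. [:c:]) q)) (z, w) = poly r z * poly q w" for r q
      by (simp add: poly2_eq_poly_map_poly map_poly_smult map_poly_map_poly comp_def)
    have "poly2 Q (z, w) = (\<Sum>s\<in>S. poly (p s) z * poly (l s) w)"
      unfolding Q_def e[symmetric]
      using S(2) by (induction S rule: finite_induct) auto
    also have "\<dots> = (\<Sum>s\<in>S. poly B z * (poly (P z) s * poly (l s) w))"
      using S(1) p[OF _ z, symmetric] by (intro sum.cong) auto
    also have "\<dots> = poly B z * poly (\<Sum>s\<in>S. smult (poly (P z) s) (l s)) w"
      by (simp add: poly_sum sum_distrib_left)
    also have "\<dots> = poly B z * poly (P z) w"
      using l[of "P z"] P z S(3) by (simp add: monic_family_def)
    finally show ?thesis .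
  qed
  with B that show ?thesis by blast
qed

lemma uniform_limit_sum:
  fixes f :: "'i \<Rightarrow> 'a \<Rightarrow> 'b \<Rightarrow> 'c::real_normed_vector"
  assumes "\<And>i. i \<in> I \<Longrightarrow> uniform_limit X (f i) (l i) F"
  shows "uniform_limit X (\<lambda>n x. \<Sum>i\<in>I. f i n x) (\<lambda>x. \<Sum>i\<in>I. l i x) F"
  using assms
  by (induction I rule: infinite_finite_induct)
     (auto intro: uniform_limit_add uniform_limit_const)

text \<open>The function \<open>P(\<cdot>, w\<^sub>0)\<close> is the limit of the functions \<open>P(\<cdot>, w)\<close> with \<open>\<bar>w\<bar> > 1\<close>, which have no
  zeros. By Hurwitz's theorem it has no zero either unless it is constant.\<close>

lemma unimodular_root_persists:
  assumes P: "monic_family m P"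
    and roots: "\<And>z w. z \<in> \<bbbD> \<Longrightarrow> poly (P z) w = 0 \<Longrightarrow> cmod w \<le> 1"
    and z0: "z0 \<in> \<bbbD>" "cmod w0 = 1" "poly (P z0) w0 = 0" and z: "z \<in> \<bbbD>"
  shows "poly (P z) w0 = 0"
proof -
  define u where "u n = (1 + inverse (real (Suc n))) *\<^sub>R w0" for n
  have "u \<longlonglongrightarrow> (1 + 0) *\<^sub>R w0"
    unfolding u_def by (intro tendsto_intros LIMSEQ_inverse_real_of_nat)
  then have u: "u \<longlonglongrightarrow> w0" by simp
  have cu: "cmod (u n) > 1" for n using z0(2) by (simp add: u_def)
  have "(\<lambda>z. poly (P z) w0) constant_on \<bbbD>"
  proof (rule ccontr)
    assume "\<not> (\<lambda>z. poly (P z) w0) constant_on \<bbbD>"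
    then have "poly (P z0) w0 \<noteq> 0"
    proof (rule Hurwitz_no_zeros[where \<F> = "\<lambda>n z. poly (P z) (u n)" and S = "\<bbbD>", rotated 5])
      show "poly (P z) (u n) \<noteq> 0" if "z \<in> \<bbbD>" for n z
        using roots[OF that, of "u n"] cu[of n] by auto
      show "(\<lambda>z. poly (P z) (u n)) holomorphic_on \<bbbD>" "(\<lambda>z. poly (P z) w0) holomorphic_on \<bbbD>" for n
        by (intro monic_family_holomorphic[OF P])+
      show "uniform_limit K (\<lambda>n z. poly (P z) (u n)) (\<lambda>z. poly (P z) w0) sequentially"
        if K: "compact K" "K \<subseteq> \<bbbD>" for K
      proof -
        have "uniform_limit K (\<lambda>n z. \<Sum>k\<le>m. coeff (P z) k * u n ^ k)
            (\<lambda>z. \<Sum>k\<le>m. coeff (P z) k * w0 ^ k) sequentially"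
        proof (intro uniform_limit_sum uniform_lim_mult uniform_limit_const)
          fix k
          have "continuous_on K (\<lambda>z. coeff (P z) k)"
            using P unfolding monic_family_def
            by (intro continuous_on_subset[OF holomorphic_on_imp_continuous_on K(2)]) blast
          then show "bounded ((\<lambda>z. coeff (P z) k) ` K)"
            using K(1) by (intro compact_imp_bounded compact_continuous_image)
          show "uniform_limit K (\<lambda>n z. u n ^ k) (\<lambda>z. w0 ^ k) sequentially"
            unfolding uniform_limit_iff using tendstoD[OF tendsto_power[OF u]]
            by (auto elim: eventually_mono)
          show "bounded ((\<lambda>z. w0 ^ k) ` K)"
            by (rule bounded_subset[of "{w0 ^ k}"]) auto
        qed
        then show ?thesis
          using K(2) monic_family_poly_eq[OF P]
          by (subst uniform_limit_cong'[where g = "\<lambda>n z. \<Sum>k\<le>m. coeff (P z) k * u n ^ k"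
                and i = "\<lambda>z. \<Sum>k\<le>m. coeff (P z) k * w0 ^ k"]) auto
      qed
    qed (use z0 in auto)
    with z0(3) show False by blast
  qed
  then show ?thesis using z0 z unfolding constant_on_def by metis
qed

lemma monic_family_divide_root:
  assumes P: "monic_family (Suc m) P" and root: "\<And>z. z \<in> \<bbbD> \<Longrightarrow> poly (P z) a = 0"
  obtains P' where "monic_family m P'" "\<And>z. z \<in> \<bbbD> \<Longrightarrow> P z = [:- a, 1:] * P' z"
proof -
  define P' where "P' z = synthetic_div (P z) a" for z
  have eq: "P z = [:- a, 1:] * P' z" if "z \<in> \<bbbD>" for z
    using synthetic_div_correct'[of a "P z"] root[OF that] by (simp add: P'_def)
  have deg: "degree (P' z) = m" if "z \<in> \<bbbD>" for z
    using P that by (simp add: P'_def degree_synthetic_div monic_family_def)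
  have rec: "coeff (P z) (Suc k) = coeff (P' z) k - a * coeff (P' z) (Suc k)" if "z \<in> \<bbbD>" for z k
    by (subst eq[OF that]) simp
  have "coeff (P' z) m = 1" if "z \<in> \<bbbD>" for z
    using rec[OF that, of m] P that deg[OF that] by (simp add: monic_family_def coeff_eq_0)
  moreover have "(\<lambda>z. coeff (P' z) k) holomorphic_on \<bbbD>" if "Suc m \<le> k + j" for j k
    using that
  proof (induction j arbitrary: k)
    case 0
    then have "coeff (P' z) k = 0" if "z \<in> \<bbbD>" for z
      using deg[OF that] by (simp add: coeff_eq_0)
    then show ?case by (subst holomorphic_cong[OF refl]) auto
  next
    case (Suc j)
    have "(\<lambda>z. coeff (P z) (Suc k) + a * coeff (P' z) (Suc k)) holomorphic_on \<bbbD>"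
      using P Suc by (intro holomorphic_intros) (auto simp: monic_family_def)
    then show ?case by (rule holomorphic_transform) (simp add: rec)
  qed
  from this[of _ "Suc m"] have "(\<lambda>z. coeff (P' z) k) holomorphic_on \<bbbD>" for k by simp
  ultimately have "monic_family m P'" using deg by (simp add: monic_family_def)
  with eq that show ?thesis by blast
qed

lemma strip_unimodular_roots:
  assumes "monic_family m P" "\<And>z w. z \<in> \<bbbD> \<Longrightarrow> poly (P z) w = 0 \<Longrightarrow> cmod w \<le> 1"
  shows "\<exists>m' P'. monic_family m' P' \<and> (\<forall>z\<in>\<bbbD>. \<forall>w. poly (P' z) w = 0 \<longleftrightarrow> poly (P z) w = 0 \<and> cmod w < 1)"
  using assms
proof (induction m arbitrary: P)
  case (0 P)
  then have "poly (P z) w \<noteq> 0" if "z \<in> \<bbbD>" for z w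
    using monic_family_poly_eq[OF 0(1) that] that by (simp add: monic_family_def)
  with 0(1) show ?case by blast
next
  case (Suc m P)
  show ?case
  proof (cases "\<exists>z\<in>\<bbbD>. \<exists>w. poly (P z) w = 0 \<and> cmod w = 1")
    case False
    then have "cmod w < 1" if "z \<in> \<bbbD>" "poly (P z) w = 0" for z w
      using Suc.prems(2)[OF that] that by (metis order_le_less)
    with Suc.prems(1) show ?thesis by blast
  next
    case True
    then obtain z0 a where z0: "z0 \<in> \<bbbD>" "poly (P z0) a = 0" and a: "cmod a = 1"
      by blast
    have "poly (P z) a = 0" if "z \<in> \<bbbD>" for z
      by (rule unimodular_root_persists[OF Suc.prems(1)]) (fact Suc.prems(2) z0 a that)+
    then obtain P' where P': "monic_family m P'" "\<And>z. z \<in> \<bbbD> \<Longrightarrow> P z = [:- a, 1:] * P' z"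
      using monic_family_divide_root[OF Suc.prems(1)] by blast
    have "cmod w \<le> 1" if "z \<in> \<bbbD>" "poly (P' z) w = 0" for z w
      using Suc.prems(2)[OF that(1), of w] that by (simp add: P'(2))
    with Suc.IH[OF P'(1)] have IH: "\<exists>m' P''. monic_family m' P'' \<and>
        (\<forall>z\<in>\<bbbD>. \<forall>w. poly (P'' z) w = 0 \<longleftrightarrow> poly (P' z) w = 0 \<and> cmod w < 1)"
      by blast
    have "poly (P z) w = 0 \<and> cmod w < 1 \<longleftrightarrow> poly (P' z) w = 0 \<and> cmod w < 1" if "z \<in> \<bbbD>" for z w
      using a by (auto simp: P'(2)[OF that])
    with IH show ?thesis by simp
  qed
qed

section \<open>The characteristic polynomial of a contractive holomorphic matrix function\<close>

lemma coeff_prod_linear: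
  assumes "finite I" "\<And>i. i \<in> I \<Longrightarrow> degree (f i) \<le> 1"
  shows "degree (\<Prod>i\<in>I. f i) \<le> card I \<and> coeff (\<Prod>i\<in>I. f i) (card I) = (\<Prod>i\<in>I. coeff (f i) 1)"
  using assms
proof (induction I)
  case (insert i I)
  let ?g = "\<Prod>i\<in>I. f i"
  have g: "degree ?g \<le> card I" "coeff ?g (card I) = (\<Prod>i\<in>I. coeff (f i) 1)"
    using insert by auto
  have fi: "degree (f i) \<le> 1" using insert by auto
  have "degree (f i * ?g) \<le> Suc (card I)"
    using degree_mult_le[of "f i" ?g] g(1) fi by linarith
  moreover have "coeff (f i * ?g) (Suc (card I)) = coeff (f i) 1 * coeff ?g (card I)"
  proof -
    have "f i = [:coeff (f i) 0, coeff (f i) 1:]"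
      by (rule poly_eqI) (use fi in \<open>auto simp: coeff_pCons coeff_eq_0 split: nat.splits\<close>)
    then have "coeff (f i * ?g) (Suc (card I)) = coeff ([:coeff (f i) 0, coeff (f i) 1:] * ?g) (Suc (card I))"
      by (rule arg_cong)
    also have "\<dots> = coeff (f i) 1 * coeff ?g (card I)"
      using g(1) by (simp add: coeff_eq_0)
    finally show ?thesis .
  qed
  ultimately show ?case using insert.hyps g(2) by simp
qed simp

text \<open>Entries of \<open>\<Psi> - w I\<close> as polynomials in \<open>w\<close>; the determinant over the ring of polynomials is the
  characteristic polynomial up to sign.\<close>

definition char_matrix :: "complex ^ 'n ^ 'n \<Rightarrow> complex poly ^ 'n ^ 'n" where
  "char_matrix A = (\<chi> i j. if i = j then [:A $ i $ j, - 1:] else [:A $ i $ j:])"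

definition char_pol :: "complex ^ 'n ^ 'n \<Rightarrow> complex poly" where
  "char_pol A = smult ((- 1) ^ CARD('n)) (det (char_matrix A))"

lemma poly_char_pol:
  fixes A :: "complex ^ 'n ^ 'n"
  shows "poly (char_pol A) w = (- 1) ^ CARD('n) * det (A - mat w)"
proof -
  have "poly (char_matrix A $ i $ j) w = (A - mat w) $ i $ j" for i j
    by (simp add: char_matrix_def mat_def)
  then have "poly (det (char_matrix A)) w = det (A - mat w)"
    unfolding det_def poly_sum poly_mult poly_prod by simp
  then show ?thesis by (simp add: char_pol_def)
qed

lemma monic_char_pol:
  fixes A :: "complex ^ 'n ^ 'n"
  shows "degree (char_pol A) = CARD('n)" "coeff (char_pol A) CARD('n) = 1"
proof -
  let ?n = "CARD('n)" and ?C = "char_matrix A"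
  define t where "t p = of_int (sign p) * (\<Prod>i\<in>UNIV. ?C $ i $ p i)" for p
  have C: "degree (?C $ i $ j) \<le> 1" "coeff (?C $ i $ j) 1 = (if i = j then - 1 else 0)" for i j
    by (auto simp: char_matrix_def)
  have t: "degree (t p) \<le> ?n" "coeff (t p) ?n = (if p = id then (- 1) ^ ?n else 0)"
    if "p permutes (UNIV :: 'n set)" for p
  proof -
    have pr: "degree (\<Prod>i\<in>UNIV. ?C $ i $ p i) \<le> ?n"
      "coeff (\<Prod>i\<in>UNIV. ?C $ i $ p i) ?n = (\<Prod>i\<in>UNIV. if i = p i then - 1 else 0)"
      using coeff_prod_linear[of UNIV "\<lambda>i. ?C $ i $ p i"] C by auto
    have s: "t p = smult (of_int (sign p)) (\<Prod>i\<in>UNIV. ?C $ i $ p i)"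
      by (simp add: t_def of_int_poly)
    show "degree (t p) \<le> ?n"
      unfolding s using pr(1) degree_smult_le order_trans by blast
    show "coeff (t p) ?n = (if p = id then (- 1) ^ ?n else 0)"
    proof (cases "p = id")
      case True
      then show ?thesis
        unfolding s coeff_smult pr(2) by (simp add: sign_id)
    next
      case False
      then obtain i where "p i \<noteq> i" by (auto simp: fun_eq_iff)
      then have "(\<Prod>i\<in>UNIV. if i = p i then - 1 else (0::complex)) = 0"
        by (intro prod_zero bexI[of _ i]) auto
      then show ?thesis
        unfolding s coeff_smult pr(2) using False by simp
    qed
  qed
  have det: "det ?C = (\<Sum>p | p permutes UNIV. t p)" by (simp add: det_def t_def)
  have "degree (det ?C) \<le> ?n"
    unfolding det using t(1) by (intro degree_sum_le) (auto intro: finite_permutations)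
  moreover have "coeff (det ?C) ?n = (\<Sum>p | p permutes (UNIV :: 'n set). if p = id then (- 1) ^ ?n else 0)"
    unfolding det coeff_sum using t(2) by (intro sum.cong) auto
  then have "coeff (det ?C) ?n = (- 1) ^ ?n"
    by (simp add: finite_permutations permutes_id)
  ultimately have "degree (char_pol A) \<le> ?n" and *: "coeff (char_pol A) ?n = 1"
    by (auto simp: char_pol_def power_mult_distrib[symmetric])
  then show "degree (char_pol A) = ?n" by (metis le_antisym le_degree one_neq_zero)
  show "coeff (char_pol A) ?n = 1" by (fact *)
qed

lemma holomorphic_coeff_prod:
  assumes "finite I" "\<And>i k. i \<in> I \<Longrightarrow> (\<lambda>z. coeff (f i z) k) holomorphic_on S"
  shows "(\<lambda>z. coeff (\<Prod>i\<in>I. f i z) k) holomorphic_on S"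
  using assms
proof (induction I arbitrary: k)
  case empty
  then show ?case by simp
next
  case (insert i I)
  have "(\<lambda>z. \<Sum>j\<le>k. coeff (f i z) j * coeff (\<Prod>i\<in>I. f i z) (k - j)) holomorphic_on S"
    using insert by (intro holomorphic_intros) auto
  then show ?case using insert.hyps by (simp add: coeff_mult)
qed

lemma monic_family_char_pol:
  fixes \<Psi> :: "complex \<Rightarrow> complex ^ 'n ^ 'n"
  assumes "contractive_holomorphic \<Psi>"
  shows "monic_family CARD('n) (\<lambda>z. char_pol (\<Psi> z))"
proof -
  have entry: "(\<lambda>z. coeff (char_matrix (\<Psi> z) $ i $ j) k) holomorphic_on \<bbbD>" for i j k
    using assms
    by (cases k; cases "k - 1"; cases "i = j")
       (auto simp: char_matrix_def contractive_holomorphic_def)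
  have "(\<lambda>z. coeff (char_pol (\<Psi> z)) k) holomorphic_on \<bbbD>" for k
  proof -
    have "coeff (det (char_matrix (\<Psi> z))) k = (\<Sum>p | p permutes (UNIV :: 'n set).
        of_int (sign p) * coeff (\<Prod>i\<in>UNIV. char_matrix (\<Psi> z) $ i $ p i) k)" for z
      by (simp add: det_def coeff_sum of_int_poly)
    then show ?thesis
      unfolding char_pol_def coeff_smult
      by (simp only:) (intro holomorphic_intros holomorphic_coeff_prod entry, auto)
  qed
  then show ?thesis by (simp add: monic_family_def monic_char_pol)
qed

lemma root_char_pol_le:
  fixes \<Psi> :: "complex \<Rightarrow> complex ^ 'n ^ 'n"
  assumes "contractive_holomorphic \<Psi>" "z \<in> \<bbbD>" "poly (char_pol (\<Psi> z)) w = 0"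
  shows "cmod w \<le> 1"
proof -
  have "det (\<Psi> z - mat w) = 0" using assms(3) by (simp add: poly_char_pol)
  then have "\<not> invertible (\<Psi> z - mat w)" by (simp add: invertible_det_nz)
  then obtain v where v: "(\<Psi> z - mat w) *v v = 0" "v \<noteq> 0"
    using matrix_left_invertible_ker[of "\<Psi> z - mat w"] invertible_left_inverse by blast
  have "mat w *v v = w *s v"
    by (simp add: vec_eq_iff matrix_vector_mult_def mat_def if_distrib[of "\<lambda>x. x * _"] cong: if_cong)
  then have "\<Psi> z *v v = w *s v"
    using v(1) by (simp add: matrix_vector_mult_diff_rdistrib)
  moreover have "norm (w *s v) = cmod w * norm v"
    by (simp add: norm_vec_def norm_mult L2_set_right_distrib)
  ultimately have "cmod w * norm v = norm (\<Psi> z *v v)"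
    by simp
  also have "\<dots> \<le> onorm ((*v) (\<Psi> z)) * norm v"
    by (rule onorm) (rule matrix_vector_mul_bounded_linear)
  also have "\<dots> \<le> 1 * norm v"
    using assms(1,2) by (intro mult_right_mono) (auto simp: contractive_holomorphic_def)
  finally show ?thesis using v(2) by simp
qed

text \<open>Unimodular eigenvalues of \<open>\<Psi>(z)\<close> lie outside the bidisc and do not contribute to the variety.\<close>

lemma variety_monic_family:
  fixes \<Psi> :: "complex \<Rightarrow> complex ^ 'n ^ 'n"
  assumes "contractive_holomorphic \<Psi>"
  obtains m P where "monic_family m P" "\<And>z w. z \<in> \<bbbD> \<Longrightarrow> poly (P z) w = 0 \<Longrightarrow> cmod w < 1"
    "variety \<Psi> = {(z, w). z \<in> \<bbbD> \<and> poly (P z) w = 0}"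
proof -
  obtain m P where P: "monic_family m P"
    "\<And>z w. z \<in> \<bbbD> \<Longrightarrow> poly (P z) w = 0 \<longleftrightarrow> poly (char_pol (\<Psi> z)) w = 0 \<and> cmod w < 1"
    using strip_unimodular_roots[OF monic_family_char_pol[OF assms]] root_char_pol_le[OF assms] by blast
  show ?thesis
    by (rule that[OF P(1)]) (auto simp: P(2) variety_def poly_char_pol)
qed

section \<open>The closure of a distinguished variety\<close>

text \<open>The part of the closure of \<open>V\<close> with \<open>\<bar>w\<bar> \<le> 1 - e\<close> is compact. As \<open>V\<close> is distinguished, it
  does not meet \<open>\<bar>z\<bar> = 1\<close>, so \<open>\<bar>z\<bar>\<close> is bounded on it by some \<open>r < 1\<close>.\<close>

lemma roots_tend_to_circle:
  assumes V: "V = {(z, w). z \<in> \<bbbD> \<and> poly (P z) w = 0}"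
    and roots: "\<And>z w. z \<in> \<bbbD> \<Longrightarrow> poly (P z) w = 0 \<Longrightarrow> cmod w < 1"
    and "distinguished V" "e > 0"
  shows "eventually (\<lambda>z. \<forall>w. poly (P z) w = 0 \<longrightarrow> 1 - cmod w \<le> e) at_circle"
proof -
  have VD: "V \<subseteq> \<bbbD> \<times> \<bbbD>" using roots by (auto simp: V)
  have clD: "closure V \<subseteq> closure (\<bbbD> \<times> \<bbbD>)" using VD by (rule closure_mono)
  have bdV: "bounded V" using VD bounded_subset[OF bounded_Times[OF bounded_ball bounded_ball]] by blast
  define K where "K = closure V \<inter> {x. cmod (snd x) \<le> 1 - e}"
  have "closed {x::complex \<times> complex. cmod (snd x) \<le> 1 - e}"
    by (intro closed_Collect_le continuous_intros)
  then have K: "compact K"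
    unfolding K_def using bdV by (intro compact_Int_closed) (simp add: compact_closure)
  have lt: "cmod (fst x) < 1" if "x \<in> K" for x
  proof (rule ccontr)
    assume "\<not> cmod (fst x) < 1"
    then have "x \<notin> interior (\<bbbD> \<times> \<bbbD>)" by (cases x) (auto simp: interior_open open_Times)
    then have "x \<in> closure V \<inter> frontier (\<bbbD> \<times> \<bbbD>)"
      using that clD by (auto simp: K_def frontier_def)
    then have "cmod (snd x) = 1"
      using \<open>distinguished V\<close> unfolding distinguished_def by (cases x) auto
    then show False using that \<open>e > 0\<close> by (simp add: K_def)
  qed
  have "\<exists>r<1. \<forall>x\<in>K. cmod (fst x) \<le> r"
  proof (cases "K = {}")
    case False
    have "continuous_on K (\<lambda>x. cmod (fst x))" by (intro continuous_intros)
    with False obtain x where "x \<in> K" "\<forall>y\<in>K. cmod (fst y) \<le> cmod (fst x)"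
      using continuous_attains_sup[OF K] by blast
    then show ?thesis using lt by blast
  qed (auto intro: exI[of _ 0])
  then obtain r where r: "r < 1" "\<And>x. x \<in> K \<Longrightarrow> cmod (fst x) \<le> r" by blast
  have "1 - cmod w \<le> e" if "max r (1/2) < cmod z" "cmod z < 1" "poly (P z) w = 0" for z w
  proof (rule ccontr)
    assume "\<not> 1 - cmod w \<le> e"
    moreover have "(z, w) \<in> closure V"
      using that closure_subset by (force simp: V)
    ultimately have "(z, w) \<in> K" by (simp add: K_def)
    from r(2)[OF this] that show False by simp
  qed
  then show ?thesis
    unfolding eventually_at_circle using r(1) by (intro exI[of _ "max r (1/2)"]) auto
qed

text \<open>Over a boundary point \<open>z\<close>, a zero \<open>w\<close> of \<open>Q(z, \<cdot>)\<close> makes \<open>P(rz, w)\<close> small as \<open>r\<close> tends to \<open>1\<close>; a monic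
  polynomial that is small at \<open>w\<close> has a root near \<open>w\<close>.\<close>

lemma closure_variety:
  assumes P: "monic_family m P" and V: "V = {(z, w). z \<in> \<bbbD> \<and> poly (P z) w = 0}"
    and B: "\<And>z. z \<in> cball 0 1 \<Longrightarrow> poly B z \<noteq> 0"
    and Q: "\<And>z w. z \<in> \<bbbD> \<Longrightarrow> poly2 Q (z, w) = poly B z * poly (P z) w"
  shows "closure V = {(z, w). cmod z \<le> 1 \<and> poly2 Q (z, w) = 0}" (is "_ = ?X")
proof
  have "?X = {x. cmod (fst x) \<le> 1} \<inter> {x. poly2 Q x = 0}" by auto
  moreover have "closed \<dots>"
    by (intro closed_Int closed_Collect_le closed_Collect_eq continuous_intros)
  ultimately have "closed ?X" by simp
  then show "closure V \<subseteq> ?X"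
    by (intro closure_minimal) (auto simp: V Q)
  show "?X \<subseteq> closure V"
  proof (rule subsetI, clarsimp)
    fix z w assume z: "cmod z \<le> 1" and zero: "poly2 Q (z, w) = 0"
    show "(z, w) \<in> closure V"
    proof (cases "cmod z < 1")
      case True
      then have "(z, w) \<in> V" using zero B[of z] by (simp add: V Q)
      then show ?thesis using closure_subset by blast
    next
      case False
      define s where "s n = (1 - inverse (real (Suc n))) *\<^sub>R z" for n
      have s: "s \<longlonglongrightarrow> z"
      proof -
        have "s \<longlonglongrightarrow> (1 - 0) *\<^sub>R z"
          unfolding s_def by (intro tendsto_intros LIMSEQ_inverse_real_of_nat)
        then show ?thesis by simp
      qed
      have sD: "s n \<in> \<bbbD>" for n
      proof -
        have "cmod (s n) = 1 - inverse (real (Suc n))"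
          using z False by (simp add: s_def inverse_le_1_iff)
        then show ?thesis by simp
      qed
      have "isCont (poly2 Q) (z, w)"
        using continuous_on_poly2[of UNIV Q] by (simp add: continuous_on_eq_continuous_at)
      then have "(\<lambda>n. poly2 Q (s n, w)) \<longlonglongrightarrow> poly2 Q (z, w)"
        by (rule isCont_tendsto_compose) (intro tendsto_intros s)
      then have "(\<lambda>n. poly2 Q (s n, w) / poly B (s n)) \<longlonglongrightarrow> poly2 Q (z, w) / poly B z"
        using B[of z] z by (intro tendsto_divide tendsto_poly s) auto
      moreover have "poly2 Q (s n, w) / poly B (s n) = poly (P (s n)) w" for n
        using B[of "s n"] sD[of n] by (simp add: Q)
      ultimately have lim: "(\<lambda>n. poly (P (s n)) w) \<longlonglongrightarrow> 0" using zero by simp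
      show ?thesis
        unfolding closure_approachable
      proof (intro allI impI)
        fix e :: real assume "e > 0"
        then have "eventually (\<lambda>n. dist (s n) z < e / 2) sequentially"
          "eventually (\<lambda>n. dist (poly (P (s n)) w) 0 < (e / 2) ^ m) sequentially"
          using tendstoD[OF s, of "e / 2"] tendstoD[OF lim, of "(e / 2) ^ m"] by auto
        then have "eventually (\<lambda>n. dist (s n) z < e / 2 \<and> cmod (poly (P (s n)) w) < (e / 2) ^ m) sequentially"
          by eventually_elim simp
        then obtain n where n: "dist (s n) z < e / 2" "cmod (poly (P (s n)) w) < (e / 2) ^ m"
          by (auto simp: eventually_sequentially)
        have "lead_coeff (P (s n)) = 1" "degree (P (s n)) = m"
          using P sD[of n] by (auto simp: monic_family_def)
        then obtain A where A: "size A = m" "poly (P (s n)) w = (\<Prod>a\<in>#A. w - a)"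
          "\<And>a. poly (P (s n)) a = 0 \<longleftrightarrow> a \<in># A"
          using monic_root_multiset[of "P (s n)"] by metis
        have "\<not> (\<forall>a. a \<in># A \<longrightarrow> e / 2 \<le> cmod (w - a))"
          using cmod_prod_mset_ge_power[of A "e / 2" w] n(2) \<open>e > 0\<close> by (auto simp: A(1,2))
        then obtain a where a: "a \<in># A" "cmod (w - a) < e / 2" by force
        have "(s n, a) \<in> V" using sD[of n] a(1) A(3) by (simp add: V)
        moreover have "dist (s n, a) (z, w) < e"
        proof -
          have "dist (s n, a) (z, w) \<le> dist (s n) z + dist a w"
            unfolding dist_Pair_Pair by (rule sqrt_sum_squares_le_sum) auto
          then show ?thesis using n(1) a(2) by (simp add: dist_norm norm_minus_commute)
        qed
        ultimately show "\<exists>y\<in>V. dist y (z, w) < e" by blast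
      qed
    qed
  qed
qed

theorem theorem2p6:
  fixes T1 T2 :: "'h::chilbert_space \<Rightarrow> 'h"
    and \<Psi> :: "complex \<Rightarrow> complex ^ 'n ^ 'n"
    and V :: "(complex \<times> complex) set"
  assumes "contraction T1" and "contraction T2"
    and "T1 \<circ> T2 = T2 \<circ> T1"
    and "V = variety \<Psi>"
    and "agler_mccarthy_variety \<Psi> T1 T2"
    and "distinguished V"
  shows "spectral_set (closure V) T1 T2"
proof -
  have contr: "contractive_holomorphic \<Psi>"
    and vN: "\<And>p. onorm (poly2_op p T1 T2) \<le> sup_norm V (poly2 p)"
    using assms(5) unfolding assms(4) agler_mccarthy_variety_def by blast+
  obtain m P where P: "monic_family m P" "\<And>z w. z \<in> \<bbbD> \<Longrightarrow> poly (P z) w = 0 \<Longrightarrow> cmod w < 1"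
    "V = {(z, w). z \<in> \<bbbD> \<and> poly (P z) w = 0}"
    using variety_monic_family[OF contr] unfolding assms(4) by blast
  obtain Q B where B: "\<And>z. z \<in> cball 0 1 \<Longrightarrow> poly B z \<noteq> 0"
    and Q: "\<And>z w. z \<in> \<bbbD> \<Longrightarrow> poly2 Q (z, w) = poly B z * poly (P z) w"
  proof (rule monic_family_algebraic[OF P(1)])
    show "cmod w \<le> 1" if "z \<in> \<bbbD>" "poly (P z) w = 0" for z w
      using P(2)[OF that] by simp
    show "eventually (\<lambda>z. \<forall>w. poly (P z) w = 0 \<longrightarrow> 1 - cmod w \<le> e) at_circle" if "e > 0" for e
      by (rule roots_tend_to_circle[OF P(3) _ assms(6) that]) (rule P(2))
  qed blast
  have X: "closure V = {(z, w). cmod z \<le> 1 \<and> poly2 Q (z, w) = 0}"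
    by (rule closure_variety[OF P(1,3) B Q])
  have "V \<subseteq> \<bbbD> \<times> \<bbbD>" using P(2) by (auto simp: P(3))
  then have "bounded V" using bounded_subset[OF bounded_Times[OF bounded_ball bounded_ball]] by blast
  then have compact: "compact (closure V)" by (simp add: compact_closure)
  show ?thesis
  proof (rule spectral_set_closureI)
    show "bounded_clinear T1" "bounded_clinear T2"
      using assms(1,2) by (auto simp: contraction_def)
    show "\<exists>u. \<forall>x\<in>V. cmod (poly2 u x - 1 / poly2 q x) \<le> e"
      if "\<And>x. x \<in> closure V \<Longrightarrow> poly2 q x \<noteq> 0" "e > 0" for q e
    proof -
      have "\<exists>u. \<forall>x\<in>closure V. cmod (poly2 u x - 1 / poly2 q x) \<le> e"
        by (rule approx_inverse_on_curve[of _ Q]) (use that compact in \<open>auto simp: X\<close>)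
      then show ?thesis using closure_subset by blast
    qed
    show "\<exists>q. poly2 q (a, b) = 0 \<and> (\<forall>x\<in>closure V. poly2 q x \<noteq> 0)" if "(a, b) \<notin> closure V" for a b
      \<comment> \<open>Either \<open>Q\<close> minus its value at the point, or the vertical line through the point.\<close>
    proof (cases "cmod a \<le> 1")
      case True
      then have "poly2 Q (a, b) \<noteq> 0" using that by (simp add: X)
      then show ?thesis
        by (intro exI[of _ "Q - [:[:poly2 Q (a, b):]:]"]) (auto simp: X)
    next
      case False
      then show ?thesis
        by (intro exI[of _ "[:[:- a, 1:]:]"]) (auto simp: X)
    qed
  qed fact+
qed

end
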